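(* There is no polynomial $p$ such that for every XOR-clause-set $F$ there exists a UR-representation $F'$ of $F$ (a clause-set) with $\ell(F') \le p(\ell(F))$.
   Context: Literals are variables $v$ or their complements $\overline{v}$ (with $\overline{\overline{x}}=x$). A clause is a finite set of literals containing no complementary pair; $\bot$ is the empty clause. A clause-set is a finite set of clauses (read as a CNF); $\top$ is the empty clause-set. $\mathrm{var}(F)$ is the set of variables occurring in $F$; $\ell(F)=\sum_{C\in F}|C|$. A partial assignment $\varphi$ maps a finite set $\mathrm{var}(\varphi)$ of variables to $\{0,1\}$; $\varphi * F$ is obtained by deleting clauses containing a literal set to $1$ and deleting literals set to $0$ from the remaining clauses. $F$ is satisfiable iff some $\varphi$ gives $\varphi*F=\top$. Unit-clause propagation $r_1$: $r_1(F)=\{\bot\}$ if $\bot\in F$; if $F$ contains a unit clause $\{x\}$, $r_1(F)=r_1(\langle x\to 1\rangle * F)$; otherwise $r_1(F)=F$. An XOR-clause is a clause $C$ read as the constraint $\bigoplus_{x\in C} x = 0$ over $\mathbb{Z}_2$ (the value of $\overline{v}$ being $1\oplus v$); an XOR-clause-set is a finite set of XOR-clauses read as their conjunction, defining a boolean function on the variables $\mathrm{var}(F)$. A CNF-representation of an XOR-clause-set $F$ is a clause-set $F'$ with $\mathrm{var}(F)\subseteq \mathrm{var}(F')$ such that for every total assignment $\varphi$ of $\mathrm{var}(F)$, $\varphi*F'$ is satisfiable iff $\varphi$ satisfies $F$ (as XOR-clause-set). It is a UR-representation if moreover for every partial assignment $\varphi$ with $\mathrm{var}(\varphi)\subseteq\mathrm{var}(F)$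 such that $\varphi*F'$ is unsatisfiable, $r_1(\varphi*F')=\{\bot\}$. *)

theory Defs
  imports "HOL-Library.Z2" "HOL-Computational_Algebra.Polynomial"
begin

datatype 'v lit = Pos 'v | Neg 'v

fun compl_lit :: "'v lit \<Rightarrow> 'v lit" where
  "compl_lit (Pos v) = Neg v"
| "compl_lit (Neg v) = Pos v"

fun var_lit :: "'v lit \<Rightarrow> 'v" where
  "var_lit (Pos v) = v"
| "var_lit (Neg v) = v"

type_synonym 'v cls = "'v lit set"

definition is_clause :: "'v cls \<Rightarrow> bool" where
  "is_clause C \<longleftrightarrow> finite C \<and> (\<forall>x\<in>C. compl_lit x \<notin> C)"

definition is_clause_set :: "'v cls set \<Rightarrow> bool" where
  "is_clause_set F \<longleftrightarrow> finite F \<and> (\<forall>C\<in>F. is_clause C)"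

definition vars :: "'v cls set \<Rightarrow> 'v set" where
  "vars F = var_lit ` \<Union>F"

definition lit_count :: "'v cls set \<Rightarrow> nat" where
  "lit_count F = (\<Sum>C\<in>F. card C)"

text \<open>Truth values live in the two-element field, so that XOR is addition.\<close>

type_synonym 'v passign = "'v \<rightharpoonup> bit"

definition is_passign :: "'v passign \<Rightarrow> bool" where
  "is_passign \<phi> \<longleftrightarrow> finite (dom \<phi>)"

fun lit_val :: "'v passign \<Rightarrow> 'v lit \<Rightarrow> bit option" where
  "lit_val \<phi> (Pos v) = \<phi> v"
| "lit_val \<phi> (Neg v) = map_option (\<lambda>b. 1 + b) (\<phi> v)"

definition apply_pa :: "'v passign \<Rightarrow> 'v cls set \<Rightarrow> 'v cls set" where
  "apply_pa \<phi> F =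
     (\<lambda>C. {x \<in> C. lit_val \<phi> x \<noteq> Some 0}) ` {C \<in> F. \<forall>x\<in>C. lit_val \<phi> x \<noteq> Some 1}"

definition satisfiable :: "'v cls set \<Rightarrow> bool" where
  "satisfiable F \<longleftrightarrow> (\<exists>\<phi>. is_passign \<phi> \<and> apply_pa \<phi> F = {})"

fun set_true :: "'v lit \<Rightarrow> 'v passign" where
  "set_true (Pos v) = [v \<mapsto> 1]"
| "set_true (Neg v) = [v \<mapsto> 0]"

text \<open>The recursion for unit-clause propagation does not say which unit clause is
  propagated. The relation below admits every choice; it is functional and, on
  clause-sets, total (\<open>unit_prop_unique\<close>, \<open>unit_prop_ex\<close>), so \<open>r1\<close> is well-defined.\<close>

inductive unit_prop :: "'v cls set \<Rightarrow> 'v cls set \<Rightarrow> bool" where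
  conflict: "{} \<in> F \<Longrightarrow> unit_prop F {{}}"
| unit: "{} \<notin> F \<Longrightarrow> {x} \<in> F \<Longrightarrow> unit_prop (apply_pa (set_true x) F) G \<Longrightarrow> unit_prop F G"
| stop: "{} \<notin> F \<Longrightarrow> \<forall>x. {x} \<notin> F \<Longrightarrow> unit_prop F F"

definition r1 :: "'v cls set \<Rightarrow> 'v cls set" where
  "r1 F = (THE G. unit_prop F G)"

lemma lit_val_set_true:
  "lit_val (set_true x) y = (if y = x then Some 1 else if y = compl_lit x then Some 0 else None)"
  by (cases x; cases y) auto

lemma apply_set_true:
  "apply_pa (set_true x) F = (\<lambda>C. C - {compl_lit x}) ` {C \<in> F. x \<notin> C}"
proof -
  have *: "x \<noteq> compl_lit x" by (cases x) auto
  have "(\<forall>y\<in>C. lit_val (set_true x) y \<noteq> Some 1) \<longleftrightarrow> x \<notin> C" for C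
    using * by (auto simp: lit_val_set_true)
  moreover have "{y \<in> C. lit_val (set_true x) y \<noteq> Some 0} = C - {compl_lit x}" for C
    using * by (auto simp: lit_val_set_true)
  ultimately show ?thesis by (simp add: apply_pa_def)
qed

lemma compl_compl [simp]: "compl_lit (compl_lit x) = x"
  by (cases x) auto

lemma compl_neq [simp]: "compl_lit x \<noteq> x" "x \<noteq> compl_lit x"
  by (cases x; simp)+

lemma apply_set_true_commute:
  assumes "y \<noteq> x" "y \<noteq> compl_lit x"
  shows "apply_pa (set_true x) (apply_pa (set_true y) F) =
         apply_pa (set_true y) (apply_pa (set_true x) F)"
proof -
  have n: "x \<noteq> compl_lit y" using assms by auto
  have "{C \<in> (\<lambda>C. C - {compl_lit y}) ` {C \<in> F. y \<notin> C}. x \<notin> C} =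
        (\<lambda>C. C - {compl_lit y}) ` {C \<in> F. y \<notin> C \<and> x \<notin> C}"
    using n by auto
  moreover have "{C \<in> (\<lambda>C. C - {compl_lit x}) ` {C \<in> F. x \<notin> C}. y \<notin> C} =
        (\<lambda>C. C - {compl_lit x}) ` {C \<in> F. y \<notin> C \<and> x \<notin> C}"
    using assms by auto
  ultimately show ?thesis
    unfolding apply_set_true by (simp only: image_image) (intro image_cong refl, blast)
qed

lemma finite_vars: "is_clause_set F \<Longrightarrow> finite (vars F)"
  by (auto simp: is_clause_set_def is_clause_def vars_def)

lemma vars_apply_set_true: "vars (apply_pa (set_true x) F) \<subseteq> vars F - {var_lit x}"
proof
  fix v assume "v \<in> vars (apply_pa (set_true x) F)"
  then obtain C y where C: "C \<in> F" "x \<notin> C" "y \<in> C" "y \<noteq> compl_lit x" and v: "v = var_lit y"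
    by (auto simp: vars_def apply_set_true)
  then have "y \<noteq> x" by auto
  with C(4) have "var_lit y \<noteq> var_lit x" by (cases x; cases y) auto
  with C v show "v \<in> vars F - {var_lit x}" by (auto simp: vars_def)
qed

lemma vars_unit: "{x} \<in> F \<Longrightarrow> var_lit x \<in> vars F"
  unfolding vars_def by blast

lemma unit_prop_ex_finite: "finite (vars F) \<Longrightarrow> \<exists>G. unit_prop F G"
proof (induction "card (vars F)" arbitrary: F rule: less_induct)
  case less
  show ?case
  proof (cases "{} \<notin> F \<and> (\<exists>x. {x} \<in> F)")
    case True
    then obtain x where x: "{} \<notin> F" "{x} \<in> F" by blast
    have sub: "vars (apply_pa (set_true x) F) \<subset> vars F"
      using vars_apply_set_true[of x F] vars_unit[OF x(2)] by blast
    have "finite (vars (apply_pa (set_true x) F))"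
      using sub less.prems by (metis finite_subset psubset_imp_subset)
    from less.hyps[OF psubset_card_mono[OF less.prems sub] this]
    have "\<exists>G. unit_prop (apply_pa (set_true x) F) G" .
    with x show ?thesis by (blast intro: unit_prop.unit)
  next
    case False
    then show ?thesis by (blast intro: unit_prop.conflict unit_prop.stop)
  qed
qed

lemma unit_prop_ex: "is_clause_set F \<Longrightarrow> \<exists>G. unit_prop F G"
  by (simp add: unit_prop_ex_finite finite_vars)

lemma unit_prop_conflict_iff: "{} \<in> F \<Longrightarrow> unit_prop F G \<longleftrightarrow> G = {{}}"
  by (subst unit_prop.simps) simp

lemma empty_in_apply_set_true:
  assumes "{compl_lit x} \<in> F"
  shows "{} \<in> apply_pa (set_true x) F"
  unfolding apply_set_true by (rule image_eqI[of _ _ "{compl_lit x}"]) (use assms in simp_all)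

lemma empty_in_apply_set_trueD:
  assumes "{} \<in> apply_pa (set_true x) F" "{} \<notin> F"
  shows "{compl_lit x} \<in> F"
proof -
  from assms(1) obtain C where C: "C \<in> F" "C - {compl_lit x} = {}"
    unfolding apply_set_true by auto
  from C(2) have "C = {} \<or> C = {compl_lit x}" by blast
  with C(1) assms(2) show ?thesis by metis
qed

lemma unit_in_apply_set_true:
  assumes "{z} \<in> F" "z \<noteq> x" "z \<noteq> compl_lit x"
  shows "{z} \<in> apply_pa (set_true x) F"
  unfolding apply_set_true by (rule image_eqI[of _ _ "{z}"]) (use assms in auto)

lemma unit_prop_any:
  "unit_prop F G \<Longrightarrow> {} \<notin> F \<Longrightarrow> {y} \<in> F \<Longrightarrow> unit_prop (apply_pa (set_true y) F) G"
proof (induction arbitrary: y rule: unit_prop.induct)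
  case (conflict F)
  then show ?case by blast
next
  case (stop F)
  then show ?case by blast
next
  case (unit F x G)
  let ?Fx = "apply_pa (set_true x) F" and ?Fy = "apply_pa (set_true y) F"
  consider "y = x" | "y = compl_lit x" | "y \<noteq> x" "y \<noteq> compl_lit x" by blast
  then show ?case
  proof cases
    case 1
    with unit.hyps(3) show ?thesis by simp
  next
    case 2
    then have "{} \<in> ?Fx" "{} \<in> ?Fy"
      using unit.hyps(2) unit.prems(2) by (simp_all add: empty_in_apply_set_true)
    with unit.hyps(3) show ?thesis by (simp add: unit_prop_conflict_iff)
  next
    case 3
    then have n: "x \<noteq> y" "x \<noteq> compl_lit y" "compl_lit x \<noteq> y" "compl_lit x \<noteq> compl_lit y"
      by (cases x; cases y; simp)+
    have y: "{y} \<in> ?Fx" and x: "{x} \<in> ?Fy"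
      using 3 n unit.hyps(2) unit.prems(2) by (simp_all add: unit_in_apply_set_true)
    have both: "unit_prop (apply_pa (set_true x) ?Fy) G"
    proof (cases "{} \<in> ?Fx")
      case True
      then have "{compl_lit x} \<in> ?Fy"
        using empty_in_apply_set_trueD unit.hyps(1) n(3,4) by (blast intro: unit_in_apply_set_true)
      then have "{} \<in> apply_pa (set_true x) ?Fy" by (rule empty_in_apply_set_true)
      moreover have "G = {{}}" using True unit.hyps(3) by (simp add: unit_prop_conflict_iff)
      ultimately show ?thesis by (simp add: unit_prop_conflict_iff)
    next
      case False
      from unit.IH[OF False y] show ?thesis by (simp only: apply_set_true_commute[OF 3])
    qed
    show ?thesis
    proof (cases "{} \<in> ?Fy")
      case True
      then have "{compl_lit y} \<in> ?Fx"
        using empty_in_apply_set_trueD unit.prems(1) n by (metis unit_in_apply_set_true)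
      then have "{} \<in> apply_pa (set_true y) ?Fx" by (rule empty_in_apply_set_true)
      then have "{} \<in> apply_pa (set_true x) ?Fy" by (simp only: apply_set_true_commute[OF 3])
      with both True show ?thesis by (simp add: unit_prop_conflict_iff)
    next
      case False
      from False x both show ?thesis by (rule unit_prop.unit)
    qed
  qed
qed

lemma unit_prop_unique: "unit_prop F G \<Longrightarrow> unit_prop F H \<Longrightarrow> G = H"
proof (induction arbitrary: H rule: unit_prop.induct)
  case (conflict F)
  then show ?case by (simp add: unit_prop_conflict_iff)
next
  case (unit F x G)
  from unit.IH[OF unit_prop_any[OF unit.prems unit.hyps(1,2)]] show ?case .
next
  case (stop F)
  from stop.prems show ?case by cases (use stop.hyps in auto)
qed

lemma r1_eq: "unit_prop F G \<Longrightarrow> r1 F = G"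
  unfolding r1_def by (rule the_equality) (simp_all add: unit_prop_unique)

lemma r1_conflict: "{} \<in> F \<Longrightarrow> r1 F = {{}}"
  by (simp add: r1_eq unit_prop.conflict)

lemma r1_unit:
  assumes "is_clause_set F" "{} \<notin> F" "{x} \<in> F"
  shows "r1 F = r1 (apply_pa (set_true x) F)"
proof -
  from unit_prop_ex[OF assms(1)] obtain G where G: "unit_prop F G" ..
  from r1_eq[OF G] r1_eq[OF unit_prop_any[OF G assms(2,3)]] show ?thesis by simp
qed

lemma r1_stop: "{} \<notin> F \<Longrightarrow> \<forall>x. {x} \<notin> F \<Longrightarrow> r1 F = F"
  by (simp add: r1_eq unit_prop.stop)

text \<open>An XOR-clause-set is a clause-set under a different reading. The next predicate is
  meant for \<open>\<phi>\<close> assigning all of \<open>vars F\<close>, so that \<open>the\<close> is only applied to defined values.\<close>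

definition xor_sat :: "'v passign \<Rightarrow> 'v cls set \<Rightarrow> bool" where
  "xor_sat \<phi> F \<longleftrightarrow> (\<forall>C\<in>F. (\<Sum>x\<in>C. the (lit_val \<phi> x)) = 0)"

definition cnf_representation :: "'v cls set \<Rightarrow> 'v cls set \<Rightarrow> bool" where
  "cnf_representation F' F \<longleftrightarrow> is_clause_set F' \<and> vars F \<subseteq> vars F' \<and>
     (\<forall>\<phi>. dom \<phi> = vars F \<longrightarrow> (satisfiable (apply_pa \<phi> F') \<longleftrightarrow> xor_sat \<phi> F))"

definition ur_representation :: "'v cls set \<Rightarrow> 'v cls set \<Rightarrow> bool" where
  "ur_representation F' F \<longleftrightarrow> cnf_representation F' F \<and>
     (\<forall>\<phi>. is_passign \<phi> \<and> dom \<phi> \<subseteq> vars F \<and> \<not> satisfiable (apply_pa \<phi> F')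
        \<longrightarrow> r1 (apply_pa \<phi> F') = {{}})"

end

theory Submission
  imports Defs "HOL-Combinatorics.Permutations" "HOL-Library.Nat_Bijection"
begin

text \<open>
  The hard instances say that a set of edges of \<open>K\<^bsub>n,n\<^esub>\<close> meets every vertex an odd number of
  times. Setting the edges outside a graph \<open>S\<close> to 0 is consistent iff \<open>S\<close> has such an odd factor,
  so unit propagation on a UR-representation decides this property of \<open>S\<close>. That a literal has
  \<^emph>\<open>not\<close> been derived after \<open>t\<close> rounds is a monotone property of \<open>S\<close>, built by polynomially many
  disjunctions and binary conjunctions.

  Razborov's approximation method shows that this is impossible (Babai, Gal and Wigderson applied
  it to odd factors). Graphs of permutations have to be accepted, and the graphs of all
  monochromatic edges have to be rejected for every 2-colouring with an odd colour class. A
  property is approximated if, up to few errors, its truth on a permutation is witnessed by a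
  submatching of at most \<open>k\<close> edges that forces it on all colourings. Disjunctions preserve this.
  For a conjunction, two witnesses unite to a matching of up to \<open>2k\<close> edges; the family of these
  matchings is closed under replacing a sunflower by its core, which is wrong only for the few
  colourings that contain the core but no petal. A closed family has few minimal members of each
  size, and a random permutation rarely contains one with more than \<open>k\<close> edges.
\<close>

section \<open>Matchings, permutations and colourings\<close>

definition perm_graph :: "nat \<Rightarrow> (nat \<Rightarrow> nat) \<Rightarrow> (nat \<times> nat) set" where
  "perm_graph n \<pi> = (\<lambda>i. (i, \<pi> i)) ` {..<n}"

definition ends :: "(nat \<times> nat) set \<Rightarrow> (nat + nat) set" where
  "ends T = Inl ` fst ` T \<union> Inr ` snd ` T"

definition monochrom :: "(nat + nat) set \<Rightarrow> (nat \<times> nat) set" where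
  "monochrom X = {(i, j). Inl i \<in> X \<longleftrightarrow> Inr j \<in> X}"

definition verts :: "nat \<Rightarrow> (nat + nat) set" where
  "verts n = {..<n} <+> {..<n}"

definition matchings :: "nat \<Rightarrow> nat \<Rightarrow> (nat \<times> nat) set set" where
  "matchings n m = {T. T \<subseteq> {..<n} \<times> {..<n} \<and> inj_on fst T \<and> inj_on snd T \<and> card T \<le> m}"

lemma finite_matchings: "finite (matchings n m)"
  by (rule finite_subset[of _ "Pow ({..<n} \<times> {..<n})"]) (auto simp: matchings_def)

lemma finite_matching: "T \<in> matchings n m \<Longrightarrow> finite T"
  by (auto simp: matchings_def intro: finite_subset)

lemma matchings_subset:
  assumes "T \<in> matchings n m" "S \<subseteq> T"
  shows "S \<in> matchings n m"
proof -
  have "card S \<le> card T" using assms finite_matching by (blast intro: card_mono)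
  then show ?thesis using assms unfolding matchings_def by (auto intro: inj_on_subset)
qed

lemma finite_verts [simp]: "finite (verts n)" and card_verts: "card (verts n) = 2 * n"
  by (simp_all add: verts_def card_Plus)

lemma ends_matching: "T \<in> matchings n m \<Longrightarrow> ends T \<subseteq> verts n"
  by (auto simp: matchings_def ends_def verts_def)

lemma finite_ends: "finite T \<Longrightarrow> finite (ends T)"
  by (simp add: ends_def)

lemma card_ends:
  assumes "finite T" shows "card (ends T) \<le> 2 * card T"
proof -
  have "card (ends T) \<le> card (Inl ` fst ` T :: (nat + nat) set) + card (Inr ` snd ` T :: (nat + nat) set)"
    unfolding ends_def by (rule card_Un_le)
  also have "\<dots> \<le> card T + card T"
    using assms by (intro add_mono) (metis card_image_le finite_imageI le_trans)+
  finally show ?thesis by simp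
qed

lemma subset_perm_graph:
  assumes "\<pi> permutes {..<n}" "T \<subseteq> perm_graph n \<pi>" "card T \<le> m"
  shows "T \<in> matchings n m"
proof -
  have "inj_on snd (perm_graph n \<pi>)"
    using permutes_inj_on[OF assms(1)] by (auto simp: perm_graph_def inj_on_def)
  moreover have "inj_on fst (perm_graph n \<pi>)" by (auto simp: perm_graph_def inj_on_def)
  moreover have "perm_graph n \<pi> \<subseteq> {..<n} \<times> {..<n}"
    using permutes_in_image[OF assms(1)] by (auto simp: perm_graph_def)
  ultimately show ?thesis using assms unfolding matchings_def by (auto intro: inj_on_subset)
qed

text \<open>A matching is read off a list of length exactly \<open>m\<close> whose entries are edges
  or the filler \<open>None\<close>, an alphabet of \<open>n\<^sup>2 + 1\<close> letters.\<close>

lemma card_matchings_le: "card (matchings n m) \<le> (n\<^sup>2 + 1) ^ m"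
proof -
  let ?f = "\<lambda>xs. {e. Some e \<in> set xs} :: (nat \<times> nat) set"
  let ?A = "insert None (Some ` ({..<n} \<times> {..<n})) :: (nat \<times> nat) option set"
  let ?L = "{xs. set xs \<subseteq> ?A \<and> length xs = m}"
  have "matchings n m \<subseteq> ?f ` ?L"
  proof
    fix T assume T: "T \<in> matchings n m"
    obtain ys where ys: "set ys = T" "distinct ys"
      using finite_matching[OF T] finite_distinct_list by blast
    have len: "length ys \<le> m" using T ys by (metis (mono_tags, lifting) distinct_card matchings_def mem_Collect_eq)
    let ?xs = "map Some ys @ replicate (m - length ys) None"
    have "T = ?f ?xs" using ys by auto
    moreover have "?xs \<in> ?L" using T ys len by (auto simp: matchings_def)
    ultimately show "T \<in> ?f ` ?L" by (rule image_eqI)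
  qed
  moreover have fin: "finite ?L" by (rule finite_lists_length_eq) simp
  ultimately have "card (matchings n m) \<le> card ?L"
    by (meson card_image_le card_mono finite_imageI le_trans)
  also have "\<dots> = card ?A ^ m" by (rule card_lists_length_eq) simp
  also have "card ?A = n\<^sup>2 + 1"
    by (subst card_insert_disjoint) (auto simp: card_image card_cartesian_product power2_eq_square)
  finally show ?thesis .
qed

lemma card_perms_above_matching:
  assumes "T \<in> matchings n m"
  shows "card {\<pi>. \<pi> permutes {..<n} \<and> T \<subseteq> perm_graph n \<pi>} * (n - m) ^ card T \<le> fact n"
proof -
  have "finite T" using assms by (rule finite_matching)
  then show ?thesis using assms
  proof (induction T)
    case empty
    then show ?case using card_permutations[of "{..<n}" n] by simp
  next
    case (insert e T)
    obtain i j where e: "e = (i, j)" by (cases e)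
    let ?P = "\<lambda>T. {\<pi>. \<pi> permutes {..<n} \<and> T \<subseteq> perm_graph n \<pi>}"
    let ?J = "{..<n} - snd ` T"
    have T: "T \<in> matchings n m" using insert.prems by (rule matchings_subset) blast
    have fin: "finite (?P S)" for S
      by (rule finite_subset[of _ "{\<pi>. \<pi> permutes {..<n}}"]) (auto simp: finite_permutations)
    have ij: "i < n" "j < n" "j \<notin> snd ` T"
      using insert.prems insert.hyps e by (force simp: matchings_def)+
    have "card (snd ` T) \<le> m"
      using T insert.hyps(1) by (auto simp: matchings_def intro: order_trans[OF card_image_le])
    then have J: "n - m \<le> card ?J" using diff_card_le_card_Diff[of "snd ` T" "{..<n}"] insert.hyps(1) by simp
    \<comment> \<open>The pair \<open>(j', \<pi>)\<close> can be recovered from its image, since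
      \<open>j'\<close> is the new value at \<open>i\<close>; \<open>j' = j\<close> is allowed and
      changes nothing.\<close>
    let ?h = "\<lambda>(j', \<pi>). transpose j j' \<circ> \<pi>"
    have pi_i: "\<pi> i = j" if "\<pi> \<in> ?P (insert e T)" for \<pi>
      using that e by (auto simp: perm_graph_def)
    have "inj_on ?h (?J \<times> ?P (insert e T))"
    proof (rule inj_onI, clarify)
      fix a \<pi> b \<pi>'
      assume *: "transpose j a \<circ> \<pi> = transpose j b \<circ> \<pi>'" "\<pi> permutes {..<n}" "\<pi>' permutes {..<n}"
        "insert e T \<subseteq> perm_graph n \<pi>" "insert e T \<subseteq> perm_graph n \<pi>'"
      have "(transpose j a \<circ> \<pi>) i = a" "(transpose j b \<circ> \<pi>') i = b"
        using pi_i[of \<pi>] pi_i[of \<pi>'] *(2-5) by simp_all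
      with *(1) have ab: "a = b" by metis
      have "\<pi> x = \<pi>' x" for x
      proof -
        have "transpose j a (\<pi> x) = transpose j a (\<pi>' x)" using fun_cong[OF *(1), of x] ab by simp
        then show ?thesis by (metis transpose_involutory)
      qed
      with ab show "a = b \<and> \<pi> = \<pi>'" by auto
    qed
    moreover have "?h ` (?J \<times> ?P (insert e T)) \<subseteq> ?P T"
    proof clarify
      fix j' \<pi> assume *: "j' < n" "j' \<notin> snd ` T" "\<pi> permutes {..<n}" "insert e T \<subseteq> perm_graph n \<pi>"
      have "transpose j j' \<circ> \<pi> permutes {..<n}"
        by (rule permutes_compose[OF *(3)]) (rule permutes_swap_id, use ij * in auto)
      moreover have "T \<subseteq> perm_graph n (transpose j j' \<circ> \<pi>)"
      proof
        fix x assume x: "x \<in> T"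
        then obtain a b where ab: "x = (a, b)" "a < n" "\<pi> a = b" using *(4) by (auto simp: perm_graph_def)
        have "b \<noteq> j" "b \<noteq> j'" using x ab ij(3) *(2) by force+
        then have "(transpose j j' \<circ> \<pi>) a = b" using ab by simp
        then show "x \<in> perm_graph n (transpose j j' \<circ> \<pi>)" using ab by (auto simp: perm_graph_def)
      qed
      ultimately show "transpose j j' \<circ> \<pi> permutes {..<n} \<and> T \<subseteq> perm_graph n (transpose j j' \<circ> \<pi>)" ..
    qed
    ultimately have "card (?J \<times> ?P (insert e T)) \<le> card (?P T)"
      using fin by (rule card_inj_on_le)
    then have "(n - m) * card (?P (insert e T)) \<le> card (?P T)"
      unfolding card_cartesian_product by (rule order_trans[OF mult_le_mono1[OF J]])
    then have "(n - m) * card (?P (insert e T)) * (n - m) ^ card T \<le> fact n"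
      using insert.IH[OF T] by (meson le_trans mult_le_mono1)
    then show ?case using insert.hyps by (simp add: mult_ac)
  qed
qed

text \<open>Outside \<open>W\<close> each member of \<open>B\<close> agrees with some member of
  \<open>G\<close>, and inside \<open>W\<close> there are at most \<open>2 ^ w\<close>
  possibilities. In both applications \<open>G\<close> consists of the members of \<open>B\<close>
  with a desired property, reached by recolouring few vertices.\<close>

lemma card_le_recolour:
  assumes "finite W" "card W \<le> w" "finite G"
    and "\<And>X. X \<in> B \<Longrightarrow> \<exists>Y\<in>G. Y - W = X - W"
  shows "card B \<le> 2 ^ w * card G"
proof -
  have fibre: "finite {X. X - W = Y - W}" "card {X. X - W = Y - W} \<le> 2 ^ w" for Y
  proof -
    have sub: "{X. X - W = Y - W} \<subseteq> (\<lambda>Z. (Y - W) \<union> Z) ` Pow W"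
    proof
      fix X assume "X \<in> {X. X - W = Y - W}"
      then have "X = (Y - W) \<union> (X \<inter> W)" by auto
      then show "X \<in> (\<lambda>Z. (Y - W) \<union> Z) ` Pow W" by (intro image_eqI[of _ _ "X \<inter> W"]) auto
    qed
    show "finite {X. X - W = Y - W}" by (rule finite_subset[OF sub]) (use assms(1) in simp)
    have "card {X. X - W = Y - W} \<le> card (Pow W)"
      using sub assms(1) by (meson card_image_le card_mono finite_Pow_iff finite_imageI le_trans)
    also have "\<dots> \<le> 2 ^ w" using assms(1,2) by (simp add: card_Pow)
    finally show "card {X. X - W = Y - W} \<le> 2 ^ w" .
  qed
  have "B \<subseteq> (\<Union>Y\<in>G. {X. X - W = Y - W})"
  proof
    fix X assume "X \<in> B"
    then obtain Y where "Y \<in> G" "Y - W = X - W" using assms(4) by blast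
    then show "X \<in> (\<Union>Y\<in>G. {X. X - W = Y - W})" by (intro UN_I[of Y]) simp_all
  qed
  then have "card B \<le> card (\<Union>Y\<in>G. {X. X - W = Y - W})"
    by (rule card_mono[rotated]) (use assms(3) fibre in auto)
  also have "\<dots> \<le> (\<Sum>Y\<in>G. card {X. X - W = Y - W})" by (rule card_UN_le[OF assms(3)])
  also have "\<dots> \<le> (\<Sum>Y\<in>G. 2 ^ w)" by (rule sum_mono) (rule fibre)
  finally show ?thesis by (simp add: mult.commute)
qed

text \<open>The Erdos-Rado sunflower lemma, with a bound \<open>M\<close> that stays fixed while the
  induction lowers \<open>s\<close>. For sets of size \<open>Suc s\<close>, a largest disjoint
  subfamily either has \<open>p\<close> members, a sunflower with empty core, or its union has at
  most \<open>M\<close> points and meets every set. Then some point \<open>z\<close> lies in more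
  than \<open>M ^ s\<close> sets; it is deleted from them and put back into petals and core
  afterwards.\<close>

lemma sunflower:
  assumes "finite \<F>" "\<And>A. A \<in> \<F> \<Longrightarrow> finite A \<and> card A = s" "s * p \<le> M" "M ^ s < card \<F>"
  shows "\<exists>\<S> K. \<S> \<subseteq> \<F> \<and> card \<S> = p \<and> (\<forall>A\<in>\<S>. K \<subseteq> A) \<and> (\<forall>A\<in>\<S>. \<forall>B\<in>\<S>. A \<noteq> B \<longrightarrow> A \<inter> B \<subseteq> K)"
  using assms
proof (induction s arbitrary: \<F>)
  case 0
  then have "\<F> \<subseteq> {{}}" by (metis card_0_eq insertI1 subsetI)
  then have "card \<F> \<le> 1" using card_mono[of "{{}}" \<F>] by simp
  with 0 show ?case by simp
next
  case (Suc s)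
  define Q where "Q \<S> \<longleftrightarrow> \<S> \<subseteq> \<F> \<and> pairwise disjnt \<S>" for \<S>
  have "Q {}" by (simp add: Q_def)
  moreover have "card \<S> \<le> card \<F>" if "Q \<S>" for \<S> using that Suc.prems(1) by (simp add: Q_def card_mono)
  ultimately obtain \<S> where S: "Q \<S>" "\<And>\<S>'. Q \<S>' \<Longrightarrow> card \<S>' \<le> card \<S>"
    using ex_has_greatest_nat[of Q "{}" card "Suc (card \<F>)"] by (auto simp: less_Suc_eq_le)
  have finS: "finite \<S>" using S(1) Suc.prems(1) by (auto simp: Q_def intro: finite_subset)
  show ?case
  proof (cases "p \<le> card \<S>")
    case True
    then obtain \<S>' where "\<S>' \<subseteq> \<S>" "card \<S>' = p" by (meson obtain_subset_with_card_n)
    then have "\<S>' \<subseteq> \<F> \<and> card \<S>' = p \<and> (\<forall>A\<in>\<S>'. {} \<subseteq> A) \<and> (\<forall>A\<in>\<S>'. \<forall>B\<in>\<S>'. A \<noteq> B \<longrightarrow> A \<inter> B \<subseteq> {})"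
      using S(1) unfolding Q_def pairwise_def disjnt_def by blast
    then show ?thesis by blast
  next
    case False
    let ?Z = "\<Union>\<S>"
    have finZ: "finite ?Z" using finS S(1) Suc.prems(2) by (auto simp: Q_def)
    have "card ?Z \<le> sum card \<S>" by (rule card_Union_le_sum_card)
    also have "\<dots> = card \<S> * Suc s"
      using S(1) Suc.prems(2) by (subst sum.cong[of _ _ _ "\<lambda>_. Suc s"]) (auto simp: Q_def)
    also have "\<dots> \<le> Suc s * p" by (metis False mult.commute mult_le_mono1 nle_le)
    finally have Z: "card ?Z \<le> M" using Suc.prems(3) by linarith
    have meet: "\<exists>z\<in>?Z. z \<in> A" if A: "A \<in> \<F>" for A
    proof (rule ccontr)
      assume no: "\<not> (\<exists>z\<in>?Z. z \<in> A)"
      then have "A \<notin> \<S>" using Suc.prems(2)[OF A] by fastforce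
      moreover have "Q (insert A \<S>)"
        using S(1) A no by (auto simp: Q_def pairwise_insert disjnt_def)
      ultimately show False using S(2)[of "insert A \<S>"] finS by simp
    qed
    let ?G = "\<lambda>z. {A \<in> \<F>. z \<in> A}"
    have "\<exists>z\<in>?Z. M ^ s < card (?G z)"
    proof (rule ccontr)
      assume "\<not> ?thesis"
      then have le: "\<And>z. z \<in> ?Z \<Longrightarrow> card (?G z) \<le> M ^ s" by force
      have "\<F> \<subseteq> (\<Union>z\<in>?Z. ?G z)" using meet by blast
      then have "card \<F> \<le> card (\<Union>z\<in>?Z. ?G z)" by (rule card_mono[rotated]) (rule finite_subset[OF _ Suc.prems(1)], blast)
      also have "\<dots> \<le> (\<Sum>z\<in>?Z. card (?G z))" by (rule card_UN_le[OF finZ])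
      also have "\<dots> \<le> card ?Z * M ^ s" using sum_bounded_above[of ?Z "\<lambda>z. card (?G z)" "M ^ s"] le by simp
      also have "\<dots> \<le> M ^ Suc s" using Z by simp
      finally show False using Suc.prems(4) by simp
    qed
    then obtain z where z: "M ^ s < card (?G z)" by blast
    let ?H = "(\<lambda>A. A - {z}) ` ?G z"
    have inj: "inj_on (\<lambda>A. A - {z}) (?G z)" by (rule inj_onI) blast
    have "\<exists>\<S> K. \<S> \<subseteq> ?H \<and> card \<S> = p \<and> (\<forall>A\<in>\<S>. K \<subseteq> A) \<and> (\<forall>A\<in>\<S>. \<forall>B\<in>\<S>. A \<noteq> B \<longrightarrow> A \<inter> B \<subseteq> K)"
    proof (rule Suc.IH)
      show "finite ?H" using Suc.prems(1) by simp
      show "finite A \<and> card A = s" if "A \<in> ?H" for A using that Suc.prems(2) by auto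
      show "s * p \<le> M" using Suc.prems(3) by simp
      show "M ^ s < card ?H" using z by (simp add: card_image[OF inj])
    qed
    then obtain \<T> K where T: "\<T> \<subseteq> ?H" "card \<T> = p" "\<forall>A\<in>\<T>. K \<subseteq> A"
      "\<forall>A\<in>\<T>. \<forall>B\<in>\<T>. A \<noteq> B \<longrightarrow> A \<inter> B \<subseteq> K" by (elim exE conjE) (rule that)
    have nz: "z \<notin> A" if "A \<in> \<T>" for A using that T(1) by blast
    have inj': "inj_on (insert z) \<T>" by (rule inj_onI) (metis Diff_insert_absorb nz)
    have 1: "insert z ` \<T> \<subseteq> \<F>"
    proof clarify
      fix A assume "A \<in> \<T>"
      then obtain B where "B \<in> \<F>" "z \<in> B" "A = B - {z}" using T(1) by blast
      then show "insert z A \<in> \<F>" by (simp add: insert_absorb)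
    qed
    have 2: "card (insert z ` \<T>) = p" by (simp add: card_image[OF inj'] T(2))
    have 3: "\<forall>A\<in>insert z ` \<T>. insert z K \<subseteq> A" using T(3) by blast
    have 4: "\<forall>A\<in>insert z ` \<T>. \<forall>B\<in>insert z ` \<T>. A \<noteq> B \<longrightarrow> A \<inter> B \<subseteq> insert z K" using T(4) by blast
    from 1 2 3 4 show ?thesis by blast
  qed
qed

section \<open>Sunflowers of matchings\<close>

text \<open>An end in \<open>W\<close> takes the colour of its partner if that lies outside
  \<open>W\<close>, and leaves the set if the partner is in \<open>W\<close> too. Since
  \<open>T\<close> is a matching, no vertex receives two instructions.\<close>

lemma matching_recolour:
  assumes "inj_on fst T" "inj_on snd T" "\<And>a b. (a, b) \<in> T \<Longrightarrow> Inl a \<in> W \<or> Inr b \<in> W"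
  obtains Y where "Y - W = X - W" "Y \<subseteq> X \<union> W" "T \<subseteq> monochrom Y"
proof
  let ?Y = "(X - W) \<union> {Inl a | a b. (a, b) \<in> T \<and> Inl a \<in> W \<and> Inr b \<in> X - W}
    \<union> {Inr b | a b. (a, b) \<in> T \<and> Inr b \<in> W \<and> Inl a \<in> X - W}"
  show "?Y - W = X - W" "?Y \<subseteq> X \<union> W" by auto
  show "T \<subseteq> monochrom ?Y"
  proof clarify
    fix a b assume ab: "(a, b) \<in> T"
    have u: "a' = a \<longleftrightarrow> b' = b" if "(a', b') \<in> T" for a' b'
      using inj_onD[OF assms(1), of "(a', b')" "(a, b)"] inj_onD[OF assms(2), of "(a', b')" "(a, b)"] that ab
      by auto
    have "Inl a \<in> ?Y \<longleftrightarrow> (if Inl a \<in> W then Inr b \<in> X - W else Inl a \<in> X)"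
      using ab u by auto
    moreover have "Inr b \<in> ?Y \<longleftrightarrow> (if Inr b \<in> W then Inl a \<in> X - W else Inr b \<in> X)"
      using ab u by auto
    ultimately show "(a, b) \<in> monochrom ?Y"
      using assms(3)[OF ab] unfolding monochrom_def by (simp split: if_splits)
  qed
qed

text \<open>The colours inside \<open>Y\<close> being fixed, the events \<open>T - K \<subseteq> monochrom X\<close> depend on
  disjoint sets of vertices.\<close>

definition petals :: "(nat \<times> nat) set \<Rightarrow> (nat + nat) set \<Rightarrow> (nat \<times> nat) set set \<Rightarrow> bool" where
  "petals K Y \<S> \<longleftrightarrow>
     (\<forall>T\<in>\<S>. \<forall>(a, b)\<in>T - K. Inl a \<notin> Y \<or> Inr b \<notin> Y) \<and>
     (\<forall>T\<in>\<S>. \<forall>T'\<in>\<S>. T \<noteq> T' \<longrightarrow> ends T \<inter> ends T' \<subseteq> Y)"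

text \<open>Each petal \<open>T\<close> contributes its own factor: recolouring
  \<open>ends T - Y\<close>, at most \<open>2 * m\<close> vertices, makes \<open>T - K\<close>
  monochromatic, and by \<open>petals\<close> no other petal meets these vertices. So a share of at
  least \<open>1 / 2 ^ (2 * m)\<close> of the colourings avoiding the previous petals is
  lost.\<close>

lemma card_avoiding_petals:
  assumes "finite \<S>" "\<S> \<subseteq> matchings n m" "petals K Y \<S>"
  shows "real (card {X \<in> Pow (verts n). \<forall>T\<in>\<S>. \<not> T - K \<subseteq> monochrom X})
    \<le> (1 - 1 / 2 ^ (2 * m)) ^ card \<S> * 2 ^ (2 * n)"
  using assms
proof (induction \<S>)
  case empty
  then show ?case using card_Pow[OF finite_verts, of n] by (simp add: Pow_def card_verts)
next
  case (insert T \<S>)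
  let ?B = "{X \<in> Pow (verts n). \<forall>T\<in>\<S>. \<not> T - K \<subseteq> monochrom X}"
  let ?G = "{X \<in> ?B. T - K \<subseteq> monochrom X}"
  let ?W = "ends T - Y"
  have T: "T \<in> matchings n m" using insert.prems by simp
  have finT: "finite T" using T by (rule finite_matching)
  have cW: "card ?W \<le> 2 * m"
  proof -
    have "card ?W \<le> card (ends T)" using finite_ends[OF finT] by (rule card_mono) blast
    also have "\<dots> \<le> 2 * card T" by (rule card_ends[OF finT])
    also have "\<dots> \<le> 2 * m" using T by (simp add: matchings_def)
    finally show ?thesis .
  qed
  have "card ?B \<le> 2 ^ (2 * m) * card ?G"
  proof (rule card_le_recolour)
    show "finite ?W" using finite_ends[OF finT] by simp
    show "card ?W \<le> 2 * m" by (rule cW)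
    show "finite ?G" by simp
    fix X assume X: "X \<in> ?B"
    have "inj_on fst (T - K)" "inj_on snd (T - K)"
      using T by (auto simp: matchings_def inj_on_diff)
    moreover have "Inl a \<in> ?W \<or> Inr b \<in> ?W" if "(a, b) \<in> T - K" for a b
    proof -
      have "Inl a \<in> ends T" "Inr b \<in> ends T" using that by (force simp: ends_def)+
      moreover have "Inl a \<notin> Y \<or> Inr b \<notin> Y" using that insert.prems(2) unfolding petals_def by blast
      ultimately show ?thesis by blast
    qed
    ultimately obtain Z where Z: "Z - ?W = X - ?W" "Z \<subseteq> X \<union> ?W" "T - K \<subseteq> monochrom Z"
      by (rule matching_recolour)
    have "Z \<subseteq> verts n" using Z(2) X ends_matching[OF T] by blast
    moreover have "\<not> S - K \<subseteq> monochrom Z" if S: "S \<in> \<S>" for S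
    proof
      assume *: "S - K \<subseteq> monochrom Z"
      have "S \<noteq> T" using S insert.hyps by blast
      then have dis: "ends S \<inter> ?W = {}" using insert.prems(2) S unfolding petals_def by blast
      have "S - K \<subseteq> monochrom X"
      proof clarify
        fix a b assume ab: "(a, b) \<in> S" "(a, b) \<notin> K"
        then have "Inl a \<in> ends S" "Inr b \<in> ends S" by (force simp: ends_def)+
        then have nW: "Inl a \<notin> ?W" "Inr b \<notin> ?W" using dis by blast+
        have "(Inl a \<in> X \<longleftrightarrow> Inl a \<in> Z) \<and> (Inr b \<in> X \<longleftrightarrow> Inr b \<in> Z)"
          using Z(1) nW by blast
        then show "(a, b) \<in> monochrom X" using * ab by (auto simp: monochrom_def)
      qed
      then show False using X S by blast
    qed
    ultimately have "Z \<in> ?G" using Z(3) by blast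
    then show "\<exists>Z\<in>?G. Z - ?W = X - ?W" using Z(1) by blast
  qed
  then have "real (card ?B) \<le> real (2 ^ (2 * m) * card ?G)" by (rule of_nat_mono)
  then have B: "real (card ?B) / 2 ^ (2 * m) \<le> real (card ?G)"
    by (simp add: divide_le_eq mult.commute)
  have "{X \<in> Pow (verts n). \<forall>S\<in>insert T \<S>. \<not> S - K \<subseteq> monochrom X} = ?B - ?G" by blast
  then have "real (card {X \<in> Pow (verts n). \<forall>S\<in>insert T \<S>. \<not> S - K \<subseteq> monochrom X})
      = real (card ?B) - real (card ?G)"
    by (simp only:) (subst card_Diff_subset, auto intro!: of_nat_diff card_mono)
  also have "\<dots> \<le> (1 - 1 / 2 ^ (2 * m)) * real (card ?B)"
    using B by (simp add: algebra_simps)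
  also have "\<dots> \<le> (1 - 1 / 2 ^ (2 * m)) * ((1 - 1 / 2 ^ (2 * m)) ^ card \<S> * 2 ^ (2 * n))"
    using insert.IH insert.prems by (intro mult_left_mono) (auto simp: petals_def)
  finally show ?case using insert.hyps by (simp add: mult.assoc)
qed

lemma petals_exist:
  assumes "\<S> \<subseteq> matchings n m" "\<And>T. T \<in> \<S> \<Longrightarrow> card T = r" "r \<le> m" "2 \<le> p"
    "3 * m * (p + m\<^sup>2) \<le> M" "M ^ (3 * r) < card \<S>"
  obtains \<P> K Y where "\<P> \<subseteq> \<S>" "p \<le> card \<P>" "petals K Y \<P>" "\<And>T. T \<in> \<P> \<Longrightarrow> K \<subset> T"
proof -
  \<comment> \<open>A sunflower of the edge sets alone would allow the petals to share vertices. A petal with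
    both ends of a private edge in the core is discarded; there are at most \<open>r\<^sup>2\<close> such edges.\<close>
  define tok :: "(nat \<times> nat) set \<Rightarrow> ((nat \<times> nat) + (nat + nat)) set"
    where "tok T = T <+> ends T" for T
  have finS: "finite \<S>" using assms(1) finite_matchings by (rule finite_subset)
  have tok: "Inl e \<in> tok T \<longleftrightarrow> e \<in> T" "Inr v \<in> tok T \<longleftrightarrow> v \<in> ends T" for e v T
    by (auto simp: tok_def)
  have inj: "inj tok" by (rule injI) (metis tok(1) set_eqI)
  have ct: "finite (tok T) \<and> card (tok T) = 3 * r" if "T \<in> \<S>" for T
  proof -
    have "T \<in> matchings n m" using that assms(1) by blast
    then have T: "finite T" "inj_on fst T" "inj_on snd T"
      by (simp_all add: finite_matching) (simp_all add: matchings_def)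
    have "card (ends T) = card (fst ` T) + card (snd ` T)"
      unfolding ends_def using T(1) by (subst card_Un_disjoint) (auto simp: card_image)
    then have "card (ends T) = 2 * r" using T assms(2)[OF that] by (simp add: card_image)
    then show ?thesis using T(1) finite_ends[OF T(1)] assms(2)[OF that] by (simp add: tok_def card_Plus)
  qed
  have "\<exists>\<B> K. \<B> \<subseteq> tok ` \<S> \<and> card \<B> = p + m\<^sup>2 \<and> (\<forall>A\<in>\<B>. K \<subseteq> A) \<and>
      (\<forall>A\<in>\<B>. \<forall>B\<in>\<B>. A \<noteq> B \<longrightarrow> A \<inter> B \<subseteq> K)"
  proof (rule sunflower)
    show "finite (tok ` \<S>)" using finS by simp
    show "finite A \<and> card A = 3 * r" if "A \<in> tok ` \<S>" for A using that ct by auto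
    have "3 * r * (p + m\<^sup>2) \<le> 3 * m * (p + m\<^sup>2)" using assms(3) by (intro mult_le_mono) auto
    then show "3 * r * (p + m\<^sup>2) \<le> M" using assms(5) by linarith
    show "M ^ (3 * r) < card (tok ` \<S>)" using assms(6) by (simp add: card_image inj_on_subset[OF inj])
  qed
  then obtain \<B> C where B: "\<B> \<subseteq> tok ` \<S>" "card \<B> = p + m\<^sup>2" "\<And>A. A \<in> \<B> \<Longrightarrow> C \<subseteq> A"
    "\<And>A B. A \<in> \<B> \<Longrightarrow> B \<in> \<B> \<Longrightarrow> A \<noteq> B \<Longrightarrow> A \<inter> B \<subseteq> C" by metis
  define \<Q> where "\<Q> = {T \<in> \<S>. tok T \<in> \<B>}"
  have "\<B> = tok ` \<Q>" using B(1) by (auto simp: \<Q>_def)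
  then have cQ: "card \<Q> = p + m\<^sup>2" using B(2) by (simp add: card_image inj_on_subset[OF inj])
  define K where "K = {e. Inl e \<in> C}"
  define Y where "Y = {v. Inr v \<in> C}"
  have sub: "K \<subseteq> T" "Y \<subseteq> ends T" if "T \<in> \<Q>" for T
    using B(3)[of "tok T"] that by (auto simp: \<Q>_def K_def Y_def tok)
  have int: "T \<inter> T' \<subseteq> K" "ends T \<inter> ends T' \<subseteq> Y" if "T \<in> \<Q>" "T' \<in> \<Q>" "T \<noteq> T'" for T T'
  proof -
    have "tok T \<inter> tok T' \<subseteq> C" using that inj by (intro B(4)) (auto simp: \<Q>_def inj_eq)
    then show "T \<inter> T' \<subseteq> K" "ends T \<inter> ends T' \<subseteq> Y" by (auto simp: tok K_def Y_def)
  qed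
  define inner where "inner = {(a, b). Inl a \<in> Y \<and> Inr b \<in> Y}"
  define bad where "bad = {T \<in> \<Q>. (T - K) \<inter> inner \<noteq> {}}"
  have finQ: "finite \<Q>" using finS by (simp add: \<Q>_def)
  have "card \<Q> > 0" using cQ assms(4) by simp
  then obtain T0 where T0: "T0 \<in> \<Q>" by (metis card.empty equals0I less_numeral_extra(3))
  then have T0': "finite T0" "card T0 = r" using assms(1,2) finite_matching[of T0 n m] by (auto simp: \<Q>_def)
  have "inner \<subseteq> fst ` T0 \<times> snd ` T0" using sub(2)[OF T0] by (auto simp: inner_def ends_def)
  then have fin_inner: "finite inner" and "card inner \<le> card (fst ` T0 \<times> snd ` T0)"
    using T0'(1) finite_subset card_mono[of "fst ` T0 \<times> snd ` T0" inner] by blast+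
  moreover have "card (fst ` T0 \<times> snd ` T0) \<le> r * r"
    using card_image_le[OF T0'(1)] T0'(2) by (auto simp: card_cartesian_product intro: mult_le_mono)
  moreover have "r * r \<le> m\<^sup>2" using assms(3) by (simp add: power2_eq_square mult_le_mono)
  ultimately have inner: "card inner \<le> m\<^sup>2" by linarith
  \<comment> \<open>A discarded petal is charged to an inner edge that is private to it, so there
    are no more of them than inner pairs.\<close>
  have "\<exists>f. \<forall>T\<in>bad. f T \<in> (T - K) \<inter> inner" by (rule bchoice) (auto simp: bad_def)
  then obtain f where f: "\<And>T. T \<in> bad \<Longrightarrow> f T \<in> (T - K) \<inter> inner" by blast
  have "inj_on f bad"
  proof (rule inj_onI, rule ccontr)
    fix T T' assume *: "T \<in> bad" "T' \<in> bad" "f T = f T'" "T \<noteq> T'"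
    then have "T \<inter> T' \<subseteq> K" by (intro int) (auto simp: bad_def)
    then show False using f[OF *(1)] f[OF *(2)] *(3) by auto
  qed
  then have "card bad \<le> card inner" using f fin_inner by (intro card_inj_on_le[of f]) auto
  then have bad: "card bad \<le> m\<^sup>2" using inner by simp
  have "card (\<Q> - bad) = card \<Q> - card bad"
    using finQ by (intro card_Diff_subset) (auto simp: bad_def intro: finite_subset)
  then have p: "p \<le> card (\<Q> - bad)" using bad cQ by simp
  have "petals K Y (\<Q> - bad)"
    unfolding petals_def using int(2) by (auto simp: bad_def inner_def)
  moreover have "K \<subset> T" if T: "T \<in> \<Q> - bad" for T
  proof -
    \<comment> \<open>By \<open>2 \<le> p\<close> there is a second petal. If \<open>K\<close> were
      all of \<open>T\<close>, this petal would contain \<open>T\<close> and, having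
      \<open>r\<close> edges too, equal it.\<close>
    have "card (\<Q> - bad - {T}) \<noteq> 0" using p assms(4) T finQ by (simp add: card_Diff_subset)
    then obtain T' where T': "T' \<in> \<Q>" "T' \<noteq> T" by (metis Diff_iff card.empty equals0I singletonI)
    have "K \<noteq> T"
    proof
      assume "K = T"
      then have "T \<subseteq> T'" using sub(1)[OF T'(1)] by simp
      moreover have "finite T'" "card T' = card T" using T T'(1) assms(1,2) finite_matching[of T' n m] by (auto simp: \<Q>_def)
      ultimately show False using T'(2) by (metis card_subset_eq)
    qed
    then show ?thesis using sub(1) T by blast
  qed
  moreover have "\<Q> - bad \<subseteq> \<S>" by (auto simp: \<Q>_def)
  ultimately show ?thesis using that p by blast
qed

section \<open>Closing a family of matchings under replacing sunflowers by their cores\<close>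

definition plucked :: "nat \<Rightarrow> (nat \<times> nat) set \<Rightarrow> (nat \<times> nat) set set \<Rightarrow> (nat + nat) set set" where
  "plucked n K \<S> = {X \<in> Pow (verts n). K \<subseteq> monochrom X \<and> (\<forall>T\<in>\<S>. \<not> T \<subseteq> monochrom X)}"

text \<open>\<open>plucked n K \<S>\<close> are the colourings on which replacing
  \<open>\<S>\<close> by \<open>K\<close> is wrong. Closure refers only to their number, not to
  sunflowers, so that sunflowers enter only when minimal members are counted.\<close>

definition pluck_closed :: "nat \<Rightarrow> nat \<Rightarrow> real \<Rightarrow> (nat \<times> nat) set set \<Rightarrow> bool" where
  "pluck_closed n m \<delta> \<C> \<longleftrightarrow>
     (\<forall>\<S> K. \<S> \<subseteq> \<C> \<and> K \<in> matchings n m \<and> real (card (plucked n K \<S>)) \<le> \<delta> \<longrightarrow> K \<in> \<C>)"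

text \<open>Every added matching spoils at most \<open>\<delta>\<close> colourings, and there are at
  most \<open>card (matchings n m)\<close> of them. The closure is a family of largest cardinality
  among those within this error budget; one further replacement would produce a larger such
  family.\<close>

lemma pluck_closure:
  fixes \<delta> :: real
  assumes "\<T> \<subseteq> matchings n m" "0 \<le> \<delta>"
  obtains \<C> D where "\<T> \<subseteq> \<C>" "\<C> \<subseteq> matchings n m" "D \<subseteq> Pow (verts n)"
    "real (card D) \<le> \<delta> * card (matchings n m)"
    "\<And>X T. X \<in> Pow (verts n) - D \<Longrightarrow> T \<in> \<C> \<Longrightarrow> T \<subseteq> monochrom X \<Longrightarrow> \<exists>T'\<in>\<T>. T' \<subseteq> monochrom X"
    "pluck_closed n m \<delta> \<C>"
proof -
  define sound where "sound \<C> D \<longleftrightarrow> D \<subseteq> Pow (verts n) \<and> real (card D) \<le> \<delta> * card \<C> \<and>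
    (\<forall>X\<in>Pow (verts n) - D. \<forall>T\<in>\<C>. T \<subseteq> monochrom X \<longrightarrow> (\<exists>T'\<in>\<T>. T' \<subseteq> monochrom X))" for \<C> D
  define P where "P \<C> \<longleftrightarrow> \<T> \<subseteq> \<C> \<and> \<C> \<subseteq> matchings n m \<and> (\<exists>D. sound \<C> D)" for \<C>
  have "sound \<T> {}" unfolding sound_def using assms(2) by auto
  then have "P \<T>" unfolding P_def using assms(1) by blast
  moreover have bound: "card \<C> \<le> card (matchings n m)" if "P \<C>" for \<C>
    using that unfolding P_def by (meson card_mono finite_matchings)
  ultimately obtain \<C> where C: "P \<C>" "\<And>\<C>'. P \<C>' \<Longrightarrow> card \<C>' \<le> card \<C>"
    using ex_has_greatest_nat[of P \<T> card "Suc (card (matchings n m))"] by (auto simp: less_Suc_eq_le)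
  obtain D where D: "sound \<C> D" using C(1) unfolding P_def by blast
  have finC: "finite \<C>" using C(1) finite_matchings finite_subset unfolding P_def by blast
  have "pluck_closed n m \<delta> \<C>"
    unfolding pluck_closed_def
  proof (intro allI impI, elim conjE, rule ccontr)
    fix \<S> K assume *: "\<S> \<subseteq> \<C>" "K \<in> matchings n m" "real (card (plucked n K \<S>)) \<le> \<delta>" "K \<notin> \<C>"
    have "sound (insert K \<C>) (D \<union> plucked n K \<S>)"
      unfolding sound_def
    proof (intro conjI ballI impI)
      show "D \<union> plucked n K \<S> \<subseteq> Pow (verts n)" using D by (auto simp: sound_def plucked_def)
      have "real (card (D \<union> plucked n K \<S>)) \<le> real (card D) + real (card (plucked n K \<S>))"
        using card_Un_le[of D "plucked n K \<S>"] by linarith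
      also have "\<dots> \<le> \<delta> * card \<C> + \<delta>" using D *(3) by (auto simp: sound_def intro: add_mono)
      finally show "real (card (D \<union> plucked n K \<S>)) \<le> \<delta> * card (insert K \<C>)"
        using *(4) finC by (simp add: algebra_simps)
      fix X T assume X: "X \<in> Pow (verts n) - (D \<union> plucked n K \<S>)" "T \<in> insert K \<C>" "T \<subseteq> monochrom X"
      have "\<exists>S\<in>\<C>. S \<subseteq> monochrom X"
        using X *(1) unfolding plucked_def by blast
      then show "\<exists>T'\<in>\<T>. T' \<subseteq> monochrom X" using X(1) D unfolding sound_def by blast
    qed
    then have "P (insert K \<C>)" using C(1) *(2) unfolding P_def by blast
    from C(2)[OF this] show False using *(4) finC by simp
  qed
  moreover have "real (card D) \<le> \<delta> * card (matchings n m)"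
  proof -
    have "real (card D) \<le> \<delta> * card \<C>" using D by (simp add: sound_def)
    also have "\<dots> \<le> \<delta> * card (matchings n m)" using bound[OF C(1)] assms(2) by (intro mult_left_mono) auto
    finally show ?thesis .
  qed
  moreover have "\<T> \<subseteq> \<C>" "\<C> \<subseteq> matchings n m" using C(1) by (simp_all add: P_def)
  moreover have "D \<subseteq> Pow (verts n)"
    "\<And>X T. X \<in> Pow (verts n) - D \<Longrightarrow> T \<in> \<C> \<Longrightarrow> T \<subseteq> monochrom X \<Longrightarrow> \<exists>T'\<in>\<T>. T' \<subseteq> monochrom X"
    using D unfolding sound_def by blast+
  ultimately show ?thesis using that[of \<C> D] by blast
qed

text \<open>More than \<open>M ^ (3 * r)\<close> minimal members of size \<open>r\<close> would
  include \<open>p\<close> petals over a core \<open>K\<close>. By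
  \<open>card_avoiding_petals\<close>, few colourings accept \<open>K\<close> but no petal, so the
  closed family contains \<open>K\<close>, a proper subset of a petal, against minimality.\<close>

lemma card_minimal_le:
  assumes "\<C> \<subseteq> matchings n m" "pluck_closed n m ((1 - 1 / 2 ^ (2 * m)) ^ p * 2 ^ (2 * n)) \<C>"
    "2 \<le> p" "3 * m * (p + m\<^sup>2) \<le> M" "r \<le> m"
  shows "card {T \<in> \<C>. card T = r \<and> (\<forall>S\<in>\<C>. \<not> S \<subset> T)} \<le> M ^ (3 * r)"
proof (rule ccontr)
  let ?\<S> = "{T \<in> \<C>. card T = r \<and> (\<forall>S\<in>\<C>. \<not> S \<subset> T)}"
  assume "\<not> card ?\<S> \<le> M ^ (3 * r)"
  then have "M ^ (3 * r) < card ?\<S>" by simp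
  moreover have "?\<S> \<subseteq> matchings n m" using assms(1) by blast
  moreover have "card T = r" if "T \<in> ?\<S>" for T using that by blast
  ultimately obtain \<P> K Y where P: "\<P> \<subseteq> ?\<S>" "p \<le> card \<P>" "petals K Y \<P>" "\<And>T. T \<in> \<P> \<Longrightarrow> K \<subset> T"
    using petals_exist[of ?\<S> n m r p M] assms(3-5) by blast
  have Pm: "\<P> \<subseteq> matchings n m" using P(1) assms(1) by blast
  have finP: "finite \<P>" using Pm finite_matchings by (rule finite_subset)
  have "card \<P> \<noteq> 0" using P(2) assms(3) by linarith
  then obtain T where T: "T \<in> \<P>" by (metis card.empty equals0I)
  have KT: "K \<subset> T" using P(4)[OF T] .
  have "K \<in> matchings n m" using Pm T KT matchings_subset by blast
  moreover have "real (card (plucked n K \<P>)) \<le> (1 - 1 / 2 ^ (2 * m)) ^ p * 2 ^ (2 * n)"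
  proof -
    have "plucked n K \<P> \<subseteq> {X \<in> Pow (verts n). \<forall>T\<in>\<P>. \<not> T - K \<subseteq> monochrom X}"
      unfolding plucked_def by blast
    then have "card (plucked n K \<P>) \<le> card {X \<in> Pow (verts n). \<forall>T\<in>\<P>. \<not> T - K \<subseteq> monochrom X}"
      by (rule card_mono[rotated]) simp
    then have "real (card (plucked n K \<P>)) \<le> (1 - 1 / 2 ^ (2 * m)) ^ card \<P> * 2 ^ (2 * n)"
      using card_avoiding_petals[OF finP Pm P(3)] by linarith
    also have "\<dots> \<le> (1 - 1 / 2 ^ (2 * m)) ^ p * 2 ^ (2 * n)"
      using P(2) by (intro mult_right_mono power_decreasing) auto
    finally show ?thesis .
  qed
  moreover have "\<P> \<subseteq> \<C>" using P(1) by blast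
  ultimately have "K \<in> \<C>" using assms(2) unfolding pluck_closed_def by blast
  then show False using T P(1) KT by blast
qed

text \<open>Recolouring the ends of \<open>T\<close> makes it monochromatic; a spare vertex
  \<open>v\<close>, which exists because of \<open>k < n\<close>, then corrects the parity. Together
  these are at most \<open>2 * k + 1\<close> vertices.\<close>

lemma card_odd_sets_above_matching:
  assumes "T \<in> matchings n k" "k < n"
  shows "2 ^ (2 * n) \<le> 2 ^ (2 * k + 1) * card {X \<in> Pow (verts n). odd (card X) \<and> T \<subseteq> monochrom X}"
proof -
  have finT: "finite T" using assms(1) by (rule finite_matching)
  have cT: "card (ends T) \<le> 2 * k"
    using card_ends[OF finT] assms(1) by (simp add: matchings_def)
  have sub: "ends T \<subseteq> verts n" using assms(1) by (rule ends_matching)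
  have "ends T \<noteq> verts n" using cT card_verts[of n] assms(2) by auto
  then obtain v where v: "v \<in> verts n" "v \<notin> ends T" using sub by blast
  let ?W = "insert v (ends T)"
  have "card (Pow (verts n)) \<le>
      2 ^ (2 * k + 1) * card {X \<in> Pow (verts n). odd (card X) \<and> T \<subseteq> monochrom X}"
  proof (rule card_le_recolour)
    show "finite ?W" using finite_ends[OF finT] by simp
    show "card ?W \<le> 2 * k + 1" using cT v(2) finite_ends[OF finT] by simp
    show "finite {X \<in> Pow (verts n). odd (card X) \<and> T \<subseteq> monochrom X}" by simp
    fix X assume X: "X \<in> Pow (verts n)"
    have T: "inj_on fst T" "inj_on snd T" using assms(1) by (auto simp: matchings_def)
    have e: "Inl a \<in> ends T" "Inr b \<in> ends T" if "(a, b) \<in> T" for a b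
      using that by (force simp: ends_def)+
    obtain Y where Y: "Y - ends T = X - ends T" "Y \<subseteq> X \<union> ends T" "T \<subseteq> monochrom Y"
      using matching_recolour[OF T, of "ends T" X] e by blast
    have Yv: "Y \<subseteq> verts n" using Y(2) X sub by blast
    have finY: "finite Y" using Yv by (rule finite_subset) simp
    define Z where "Z = (if odd (card Y) then Y else if v \<in> Y then Y - {v} else insert v Y)"
    have "odd (card Z)"
      using finY by (auto simp: Z_def card_Diff_singleton card_gt_0_iff)
    moreover have "Z \<subseteq> verts n" using Yv v(1) by (auto simp: Z_def)
    moreover have "T \<subseteq> monochrom Z"
    proof clarify
      fix a b assume ab: "(a, b) \<in> T"
      then have "Inl a \<noteq> v" "Inr b \<noteq> v" using e v(2) by blast+
      moreover have "Inl a \<in> Y \<longleftrightarrow> Inr b \<in> Y" using Y(3) ab by (auto simp: monochrom_def)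
      ultimately show "(a, b) \<in> monochrom Z" by (auto simp: Z_def monochrom_def)
    qed
    moreover have "Z - ?W = X - ?W"
    proof -
      have "Z - ?W = Y - ends T - {v}" by (auto simp: Z_def)
      then show ?thesis using Y(1) by blast
    qed
    ultimately show "\<exists>Z\<in>{X \<in> Pow (verts n). odd (card X) \<and> T \<subseteq> monochrom X}. Z - ?W = X - ?W" by blast
  qed
  then show ?thesis by (simp add: card_Pow card_verts)
qed

section \<open>The approximation method\<close>

text \<open>Witnesses have at most \<open>k\<close> edges and unions of two at most
  \<open>2 * k\<close>, so the counting lemmas are applied with \<open>m = 2 * k\<close>;
  \<open>M_ge\<close> is their sunflower condition. At most \<open>M ^ (3 * r)\<close> minimal
  members of size \<open>r\<close>, each in a share of at most \<open>1 / (n - 2 * k) ^ r\<close> of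
  the permutations, reach by \<open>n_ge\<close> a share of at most
  \<open>1 / L ^ r\<close>.\<close>

locale matching_approximation =
  fixes n k p M L :: nat
  assumes k_pos: "0 < k" and p_ge: "2 \<le> p" and M_ge: "6 * k * (p + 4 * k\<^sup>2) \<le> M"
    and n_ge: "M ^ 3 * L \<le> n - 2 * k" and L_ge: "k \<le> L" and n_gt: "2 * k < n"
begin

definition perms :: "(nat \<Rightarrow> nat) set" where
  "perms = {\<pi>. \<pi> permutes {..<n}}"

definition odd_sets :: "(nat + nat) set set" where
  "odd_sets = {X \<in> Pow (verts n). odd (card X)}"

text \<open>The bound of \<open>card_avoiding_petals\<close> for \<open>p\<close> petals and
  \<open>m = 2 * k\<close>.\<close>

definition \<delta> :: real where
  "\<delta> = (1 - 1 / 2 ^ (4 * k)) ^ p * 2 ^ (2 * n)"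

text \<open>The approximator stays implicit: it is the disjunction over all \<open>T\<close> with at
  most \<open>k\<close> edges that force \<open>g\<close> on the odd colourings outside
  \<open>D\<close>. Thus \<open>D\<close> covers the odd colourings that it accepts wrongly, and
  \<open>E\<close> the permutations that it rejects wrongly.\<close>

definition approximable ::
    "(nat + nat) set set \<Rightarrow> (nat \<Rightarrow> nat) set \<Rightarrow> ((nat \<times> nat) set \<Rightarrow> bool) \<Rightarrow> bool" where
  "approximable D E g \<longleftrightarrow>
     (\<forall>\<pi>\<in>perms - E. g (perm_graph n \<pi>) \<longrightarrow>
        (\<exists>T\<subseteq>perm_graph n \<pi>. card T \<le> k \<and>
           (\<forall>X\<in>odd_sets - D. T \<subseteq> monochrom X \<longrightarrow> g (monochrom X))))"

text \<open>\<open>N\<close> counts binary conjunctions; the two factors bound the errors that a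
  single one adds, from \<open>pluck_closure\<close> and from
  \<open>card_perms_above_minimal\<close>.\<close>

definition few_errors :: "nat \<Rightarrow> (nat + nat) set set \<Rightarrow> (nat \<Rightarrow> nat) set \<Rightarrow> bool" where
  "few_errors N D E \<longleftrightarrow> D \<subseteq> Pow (verts n) \<and> E \<subseteq> perms \<and>
     real (card D) \<le> N * (\<delta> * card (matchings n (2 * k))) \<and> real (card E) \<le> N * (fact n / L ^ k)"

lemma finite_perms: "finite perms" and card_perms: "card perms = fact n"
  unfolding perms_def by (simp_all add: finite_permutations card_permutations[of "{..<n}" n])

lemma finite_perm_graph [simp]: "finite (perm_graph n \<pi>)"
  by (simp add: perm_graph_def)

lemma \<delta>_nonneg: "0 \<le> \<delta>"
  unfolding \<delta>_def by simp

lemma few_errors_0: "few_errors 0 {} {}"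
  by (simp add: few_errors_def)

lemma few_errors_mono:
  assumes "few_errors N D E" "N \<le> N'"
  shows "few_errors N' D E"
proof -
  have "real N * (\<delta> * card (matchings n (2 * k))) \<le> real N' * (\<delta> * card (matchings n (2 * k)))"
    "real N * (fact n / L ^ k) \<le> real N' * (fact n / L ^ k)"
    using assms(2) \<delta>_nonneg by (intro mult_right_mono; simp)+
  then show ?thesis using assms(1) unfolding few_errors_def by linarith
qed

lemma approximable_mono:
  assumes "approximable D E g" "D \<subseteq> D'" "E \<subseteq> E'"
  shows "approximable D' E' g"
  unfolding approximable_def
proof (intro ballI impI)
  fix \<pi> assume *: "\<pi> \<in> perms - E'" "g (perm_graph n \<pi>)"
  then have "\<pi> \<in> perms - E" using assms(3) by blast
  from assms(1)[unfolded approximable_def, rule_format, OF this *(2)]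
  obtain T where "T \<subseteq> perm_graph n \<pi>" "card T \<le> k"
    "\<forall>X\<in>odd_sets - D. T \<subseteq> monochrom X \<longrightarrow> g (monochrom X)" by metis
  then show "\<exists>T\<subseteq>perm_graph n \<pi>. card T \<le> k \<and> (\<forall>X\<in>odd_sets - D'. T \<subseteq> monochrom X \<longrightarrow> g (monochrom X))"
    using assms(2) by (intro exI[of _ T]) auto
qed

lemma approximable_True: "approximable D E (\<lambda>S. True)"
  unfolding approximable_def by (intro ballI impI exI[of _ "{}"]) simp

lemma approximable_mem: "approximable D E (\<lambda>S. e \<in> S)"
  unfolding approximable_def using k_pos by (intro ballI impI exI[of _ "{e}"]) simp

lemma approximable_Bex:
  assumes "\<And>z. z \<in> Z \<Longrightarrow> approximable D E (g z)"
  shows "approximable D E (\<lambda>S. \<exists>z\<in>Z. g z S)"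
  unfolding approximable_def
proof (intro ballI impI, elim bexE)
  fix \<pi> z assume *: "\<pi> \<in> perms - E" "z \<in> Z" "g z (perm_graph n \<pi>)"
  then obtain T where "T \<subseteq> perm_graph n \<pi>" "card T \<le> k"
    "\<forall>X\<in>odd_sets - D. T \<subseteq> monochrom X \<longrightarrow> g z (monochrom X)"
    using assms[OF *(2)] unfolding approximable_def by metis
  then show "\<exists>T\<subseteq>perm_graph n \<pi>. card T \<le> k \<and>
      (\<forall>X\<in>odd_sets - D. T \<subseteq> monochrom X \<longrightarrow> (\<exists>z\<in>Z. g z (monochrom X)))"
    using *(2) by (intro exI[of _ T]) auto
qed

lemma approximable_imp: "(c \<Longrightarrow> approximable D E g) \<Longrightarrow> approximable D E (\<lambda>S. c \<longrightarrow> g S)"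
  by (cases c) (simp_all add: approximable_True)

text \<open>Union bound over the sizes \<open>r\<close> from \<open>k + 1\<close> to
  \<open>2 * k\<close>: by \<open>card_minimal_le\<close> and
  \<open>card_perms_above_matching\<close>, each size contributes a share of at most
  \<open>1 / L ^ r \<le> 1 / L ^ (k + 1)\<close>. There are \<open>k \<le> L\<close> sizes, which
  costs one factor \<open>L\<close>.\<close>

lemma card_perms_above_minimal:
  assumes "\<C> \<subseteq> matchings n (2 * k)" "pluck_closed n (2 * k) \<delta> \<C>"
  shows "real (card {\<pi> \<in> perms. \<exists>T\<in>\<C>. T \<subseteq> perm_graph n \<pi> \<and> k < card T \<and> (\<forall>S\<in>\<C>. \<not> S \<subset> T)})
    \<le> fact n / L ^ k"
proof -
  let ?min = "\<lambda>r. {T \<in> \<C>. card T = r \<and> (\<forall>S\<in>\<C>. \<not> S \<subset> T)}"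
  let ?P = "\<lambda>T. {\<pi> \<in> perms. T \<subseteq> perm_graph n \<pi>}"
  let ?A = "{\<pi> \<in> perms. \<exists>T\<in>\<C>. T \<subseteq> perm_graph n \<pi> \<and> k < card T \<and> (\<forall>S\<in>\<C>. \<not> S \<subset> T)}"
  have finC: "finite \<C>" using assms(1) finite_matchings by (rule finite_subset)
  have Lpos: "0 < L" using k_pos L_ge by simp
  have npos: "0 < n - 2 * k" using n_gt by simp
  have one: "real (card (?P T)) \<le> fact n / (n - 2 * k) ^ r" if "T \<in> ?min r" for T r
  proof -
    have "T \<in> matchings n (2 * k)" "card T = r" using that assms(1) by auto
    then have "card (?P T) * (n - 2 * k) ^ r \<le> fact n"
      using card_perms_above_matching[of T n "2 * k"] by (simp add: perms_def)
    then have "real (card (?P T) * (n - 2 * k) ^ r) \<le> real (fact n)" by (rule of_nat_mono)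
    then show ?thesis using npos by (simp add: le_divide_eq)
  qed
  have level: "real (card (\<Union>T\<in>?min r. ?P T)) \<le> fact n / L ^ (k + 1)" if r: "r \<in> {k<..2 * k}" for r
  proof -
    have "real (card (\<Union>T\<in>?min r. ?P T)) \<le> real (\<Sum>T\<in>?min r. card (?P T))"
      using finC by (intro of_nat_mono card_UN_le) simp
    also have "\<dots> = (\<Sum>T\<in>?min r. real (card (?P T)))" by simp
    also have "\<dots> \<le> (\<Sum>T\<in>?min r. fact n / (n - 2 * k) ^ r)" by (rule sum_mono) (rule one)
    also have "\<dots> = real (card (?min r)) * (fact n / (n - 2 * k) ^ r)" by simp
    also have "\<dots> \<le> real (M ^ (3 * r)) * (fact n / (n - 2 * k) ^ r)"
    proof (rule mult_right_mono)
      have "card (?min r) \<le> M ^ (3 * r)"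
      proof (rule card_minimal_le[OF assms(1)])
        show "pluck_closed n (2 * k) ((1 - 1 / 2 ^ (2 * (2 * k))) ^ p * 2 ^ (2 * n)) \<C>"
          using assms(2) by (simp add: \<delta>_def mult.assoc[symmetric])
        show "3 * (2 * k) * (p + (2 * k)\<^sup>2) \<le> M" using M_ge by (simp add: power_mult_distrib)
      qed (use p_ge r in auto)
      then show "real (card (?min r)) \<le> real (M ^ (3 * r))" by (rule of_nat_mono)
    qed simp
    also have "\<dots> \<le> fact n / L ^ r"
    proof -
      have "M ^ (3 * r) * L ^ r = (M ^ 3 * L) ^ r" by (simp add: power_mult power_mult_distrib)
      also have "\<dots> \<le> (n - 2 * k) ^ r" using n_ge by (rule power_mono) simp
      finally have "real (M ^ (3 * r) * L ^ r) \<le> real ((n - 2 * k) ^ r)" by (rule of_nat_mono)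
      then have "fact n * real (M ^ (3 * r) * L ^ r) \<le> fact n * real ((n - 2 * k) ^ r)"
        by (rule mult_left_mono) simp
      then show ?thesis using npos Lpos by (simp add: field_simps)
    qed
    also have "\<dots> \<le> fact n / L ^ (k + 1)"
    proof -
      have "real L ^ (k + 1) \<le> real L ^ r" using r Lpos by (intro power_increasing) auto
      then show ?thesis using Lpos by (intro divide_left_mono) (auto simp del: power_Suc)
    qed
    finally show ?thesis .
  qed
  have "?A \<subseteq> (\<Union>r\<in>{k<..2 * k}. \<Union>T\<in>?min r. ?P T)"
  proof
    fix \<pi> assume "\<pi> \<in> ?A"
    then obtain T where T: "\<pi> \<in> perms" "T \<in> \<C>" "T \<subseteq> perm_graph n \<pi>" "k < card T" "\<forall>S\<in>\<C>. \<not> S \<subset> T"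
      by blast
    then have "card T \<in> {k<..2 * k}" using assms(1) by (auto simp: matchings_def)
    then show "\<pi> \<in> (\<Union>r\<in>{k<..2 * k}. \<Union>T\<in>?min r. ?P T)"
      using T by (intro UN_I[of "card T"] UN_I[of T]) simp_all
  qed
  then have "card ?A \<le> card (\<Union>r\<in>{k<..2 * k}. \<Union>T\<in>?min r. ?P T)"
    by (rule card_mono[rotated]) (rule finite_subset[OF _ finite_perms], blast)
  also have "\<dots> \<le> (\<Sum>r\<in>{k<..2 * k}. card (\<Union>T\<in>?min r. ?P T))" by (rule card_UN_le) simp
  finally have "real (card ?A) \<le> real (\<Sum>r\<in>{k<..2 * k}. card (\<Union>T\<in>?min r. ?P T))"
    by (rule of_nat_mono)
  also have "\<dots> = (\<Sum>r\<in>{k<..2 * k}. real (card (\<Union>T\<in>?min r. ?P T)))" by (rule of_nat_sum)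
  also have "\<dots> \<le> (\<Sum>r\<in>{k<..2 * k}. fact n / L ^ (k + 1))" by (rule sum_mono) (rule level)
  also have "\<dots> = k * (fact n / L ^ (k + 1))" by simp
  also have "\<dots> \<le> L * (fact n / L ^ (k + 1))" using L_ge by (intro mult_right_mono) auto
  also have "\<dots> = fact n / L ^ k" using Lpos by simp
  finally show ?thesis .
qed

text \<open>New colouring errors arise only in closing the family \<open>?\<T>\<close> of matchings
  that force both conjuncts, and new permutation errors only from minimal members of the closure
  with more than \<open>k\<close> edges.\<close>

lemma approximable_conj:
  assumes "few_errors N D E" "approximable D E g" "approximable D E h"
  obtains D' E' where "few_errors (Suc N) D' E'" "D \<subseteq> D'" "E \<subseteq> E'"
    "approximable D' E' (\<lambda>S. g S \<and> h S)"
proof -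
  let ?\<T> = "{T \<in> matchings n (2 * k). \<forall>X\<in>odd_sets - D. T \<subseteq> monochrom X \<longrightarrow> g (monochrom X) \<and> h (monochrom X)}"
  obtain \<C> D1 where C: "?\<T> \<subseteq> \<C>" "\<C> \<subseteq> matchings n (2 * k)" "D1 \<subseteq> Pow (verts n)"
    "real (card D1) \<le> \<delta> * card (matchings n (2 * k))"
    "\<And>X T. X \<in> Pow (verts n) - D1 \<Longrightarrow> T \<in> \<C> \<Longrightarrow> T \<subseteq> monochrom X \<Longrightarrow> \<exists>T'\<in>?\<T>. T' \<subseteq> monochrom X"
    "pluck_closed n (2 * k) \<delta> \<C>"
    by (rule pluck_closure[of ?\<T> n "2 * k" \<delta>]) (use \<delta>_nonneg in blast)+
  let ?E1 = "{\<pi> \<in> perms. \<exists>T\<in>\<C>. T \<subseteq> perm_graph n \<pi> \<and> k < card T \<and> (\<forall>S\<in>\<C>. \<not> S \<subset> T)}"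
  have E1: "real (card ?E1) \<le> fact n / L ^ k" using card_perms_above_minimal[OF C(2,6)] .
  have "real (card (D \<union> D1)) \<le> real (card D) + real (card D1)" "real (card (E \<union> ?E1)) \<le> real (card E) + real (card ?E1)"
    using card_Un_le[of D D1] card_Un_le[of E ?E1] by linarith+
  moreover have "real (card D) \<le> N * (\<delta> * card (matchings n (2 * k)))"
    "real (card E) \<le> N * (fact n / L ^ k)" "D \<subseteq> Pow (verts n)" "E \<subseteq> perms"
    using assms(1) by (simp_all add: few_errors_def)
  ultimately have "few_errors (Suc N) (D \<union> D1) (E \<union> ?E1)"
    using C(3,4) E1 unfolding few_errors_def of_nat_Suc distrib_right mult_1 by auto
  moreover have "approximable (D \<union> D1) (E \<union> ?E1) (\<lambda>S. g S \<and> h S)"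
    unfolding approximable_def
  proof (intro ballI impI, elim conjE)
    fix \<pi> assume pi: "\<pi> \<in> perms - (E \<union> ?E1)" "g (perm_graph n \<pi>)" "h (perm_graph n \<pi>)"
    have pi0: "\<pi> \<in> perms - E" using pi(1) by blast
    obtain T1 where T1: "T1 \<subseteq> perm_graph n \<pi>" "card T1 \<le> k"
      "\<And>X. X \<in> odd_sets - D \<Longrightarrow> T1 \<subseteq> monochrom X \<Longrightarrow> g (monochrom X)"
      using assms(2)[unfolded approximable_def, rule_format, OF pi0 pi(2)] by metis
    obtain T2 where T2: "T2 \<subseteq> perm_graph n \<pi>" "card T2 \<le> k"
      "\<And>X. X \<in> odd_sets - D \<Longrightarrow> T2 \<subseteq> monochrom X \<Longrightarrow> h (monochrom X)"
      using assms(3)[unfolded approximable_def, rule_format, OF pi0 pi(3)] by metis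
    have "card (T1 \<union> T2) \<le> 2 * k" using card_Un_le[of T1 T2] T1(2) T2(2) by linarith
    then have "T1 \<union> T2 \<in> matchings n (2 * k)"
      using pi(1) T1(1) T2(1) by (intro subset_perm_graph[of \<pi>]) (auto simp: perms_def)
    then have "T1 \<union> T2 \<in> ?\<T>" using T1(3) T2(3) by blast
    then have "T1 \<union> T2 \<in> \<C>" using C(1) by blast
    \<comment> \<open>A member of least cardinality inside \<open>T1 \<union> T2\<close> is minimal
      in all of \<open>\<C>\<close>. For \<open>\<pi>\<close> outside \<open>?E1\<close> it has at
      most \<open>k\<close> edges and serves as witness: a colouring outside \<open>D1\<close> that
      accepts it also accepts some member of \<open>?\<T>\<close>.\<close>
    then have "\<exists>T. T \<in> \<C> \<and> T \<subseteq> T1 \<union> T2" by blast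
    then obtain T where T: "T \<in> \<C>" "T \<subseteq> T1 \<union> T2"
      and min: "\<And>S. S \<in> \<C> \<and> S \<subseteq> T1 \<union> T2 \<Longrightarrow> card T \<le> card S"
      using exists_least_iff[of "\<lambda>c. \<exists>T. T \<in> \<C> \<and> T \<subseteq> T1 \<union> T2 \<and> c = card T"] by (metis not_le)
    have Tpi: "T \<subseteq> perm_graph n \<pi>" using T(2) T1(1) T2(1) by blast
    then have finT: "finite T" by (rule finite_subset) simp
    have nosub: "\<not> S \<subset> T" if "S \<in> \<C>" for S
    proof
      assume S: "S \<subset> T"
      then have "card T \<le> card S" using that T(2) by (intro min) blast
      then show False using psubset_card_mono[OF finT S] by simp
    qed
    have "card T \<le> k"
    proof (rule ccontr)
      assume "\<not> card T \<le> k"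
      then have "\<pi> \<in> ?E1" using pi0 T(1) Tpi nosub by (intro CollectI conjI bexI[of _ T] ballI) auto
      then show False using pi(1) by blast
    qed
    moreover have "g (monochrom X) \<and> h (monochrom X)"
      if X: "X \<in> odd_sets - (D \<union> D1)" "T \<subseteq> monochrom X" for X
    proof -
      obtain T' where "T' \<in> ?\<T>" "T' \<subseteq> monochrom X"
        using C(5)[OF _ T(1) X(2)] X(1) unfolding odd_sets_def by blast
      then show ?thesis using X(1) by blast
    qed
    ultimately show "\<exists>T\<subseteq>perm_graph n \<pi>. card T \<le> k \<and>
        (\<forall>X\<in>odd_sets - (D \<union> D1). T \<subseteq> monochrom X \<longrightarrow> g (monochrom X) \<and> h (monochrom X))"
      using Tpi by (intro exI[of _ T]) simp
  qed
  ultimately show ?thesis by (rule that[OF _ Un_upper1 Un_upper1])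
qed

lemma approximable_Ball:
  assumes "finite I" "few_errors N D E" "\<And>i. i \<in> I \<Longrightarrow> approximable D E (g i)"
  shows "\<exists>D' E'. few_errors (N + card I) D' E' \<and> D \<subseteq> D' \<and> E \<subseteq> E' \<and>
    approximable D' E' (\<lambda>S. \<forall>i\<in>I. g i S)"
  using assms
proof (induction I)
  case empty
  then show ?case using approximable_True by auto
next
  case (insert i I)
  then obtain D' E' where *: "few_errors (N + card I) D' E'" "D \<subseteq> D'" "E \<subseteq> E'"
    "approximable D' E' (\<lambda>S. \<forall>i\<in>I. g i S)" by auto
  have "approximable D' E' (g i)" using insert.prems(2)[of i] *(2,3) by (auto intro: approximable_mono)
  from approximable_conj[OF *(1) this *(4)] obtain D'' E'' where
    "few_errors (Suc (N + card I)) D'' E''" "D' \<subseteq> D''" "E' \<subseteq> E''"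
    "approximable D'' E'' (\<lambda>S. g i S \<and> (\<forall>i\<in>I. g i S))" by blast
  moreover have "Suc (N + card I) = N + card (insert i I)" using insert.hyps by simp
  ultimately show ?case using *(2,3) by (intro exI[of _ D''] exI[of _ E'']) auto
qed

text \<open>All \<open>y\<close> share the same two error sets, because the next round of
  propagation combines the approximations for different literals. Those already built survive later
  enlargements by \<open>approximable_mono\<close>.\<close>

lemma approximable_family_Ball:
  assumes "finite J" "finite I" "few_errors N D E"
    "\<And>y i. y \<in> J \<Longrightarrow> i \<in> I \<Longrightarrow> approximable D E (g y i)"
  shows "\<exists>D' E'. few_errors (N + card J * card I) D' E' \<and> D \<subseteq> D' \<and> E \<subseteq> E' \<and>
    (\<forall>y\<in>J. approximable D' E' (\<lambda>S. \<forall>i\<in>I. g y i S))"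
  using assms
proof (induction J)
  case empty
  then show ?case by auto
next
  case (insert y J)
  then obtain D' E' where *: "few_errors (N + card J * card I) D' E'" "D \<subseteq> D'" "E \<subseteq> E'"
    "\<forall>y\<in>J. approximable D' E' (\<lambda>S. \<forall>i\<in>I. g y i S)" by (auto simp: ball_Un)
  have "approximable D' E' (g y i)" if "i \<in> I" for i
    using insert.prems(3)[of y i] *(2,3) that by (auto intro: approximable_mono)
  from approximable_Ball[of I _ _ _ "g y", OF insert.prems(1) *(1) this] obtain D'' E'' where **:
    "few_errors (N + card J * card I + card I) D'' E''" "D' \<subseteq> D''" "E' \<subseteq> E''"
    "approximable D'' E'' (\<lambda>S. \<forall>i\<in>I. g y i S)" by blast
  have "\<forall>x\<in>insert y J. approximable D'' E'' (\<lambda>S. \<forall>i\<in>I. g x i S)"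
    using *(4) **(2-4) by (auto intro: approximable_mono)
  moreover have "few_errors (N + card (insert y J) * card I) D'' E''"
    using **(1) insert.hyps by (simp add: algebra_simps)
  ultimately show ?case using *(2,3) **(2,3) by (intro exI[of _ D''] exI[of _ E''] conjI) simp_all
qed

text \<open>By \<open>N < L ^ k\<close> some permutation lies outside \<open>E\<close>, and its
  witness \<open>T\<close> has at most \<open>k\<close> edges. The odd colourings on which
  \<open>T\<close> is monochromatic are rejected by \<open>g\<close>, so they lie in
  \<open>D\<close>; but by \<open>card_odd_sets_above_matching\<close> they are too many.\<close>

lemma approximable_not_separating:
  assumes "few_errors N D E" "approximable D E g"
    and "N * \<delta> * card (matchings n (2 * k)) * 2 ^ (2 * k + 1) < 2 ^ (2 * n)" "N < L ^ k"
    and accept: "\<And>\<pi>. \<pi> permutes {..<n} \<Longrightarrow> g (perm_graph n \<pi>)"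
    and reject: "\<And>X. X \<subseteq> verts n \<Longrightarrow> odd (card X) \<Longrightarrow> \<not> g (monochrom X)"
  shows False
proof -
  have Lpos: "0 < L" using k_pos L_ge by simp
  have "real (card E) \<le> N * (fact n / L ^ k)" using assms(1) by (simp add: few_errors_def)
  also have "\<dots> < L ^ k * (fact n / L ^ k)"
    using assms(4) Lpos by (intro mult_strict_right_mono) (simp_all flip: of_nat_power)
  also have "\<dots> = card perms" using Lpos by (simp add: card_perms)
  finally have "card E \<noteq> card perms" by simp
  then have "E \<noteq> perms" by blast
  moreover have "E \<subseteq> perms" using assms(1) by (simp add: few_errors_def)
  ultimately obtain \<pi> where pi: "\<pi> \<in> perms - E" by blast
  then have "g (perm_graph n \<pi>)" by (intro accept) (simp add: perms_def)
  then obtain T where T: "T \<subseteq> perm_graph n \<pi>" "card T \<le> k"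
    "\<And>X. X \<in> odd_sets - D \<Longrightarrow> T \<subseteq> monochrom X \<Longrightarrow> g (monochrom X)"
    using assms(2)[unfolded approximable_def, rule_format, OF pi] by metis
  have Tm: "T \<in> matchings n k" using pi T(1,2) by (intro subset_perm_graph) (auto simp: perms_def)
  let ?O = "{X \<in> Pow (verts n). odd (card X) \<and> T \<subseteq> monochrom X}"
  have D: "D \<subseteq> Pow (verts n)" using assms(1) by (simp add: few_errors_def)
  have "?O \<subseteq> D" using T(3) reject by (auto simp: odd_sets_def)
  then have "card ?O \<le> card D" by (rule card_mono[rotated]) (rule finite_subset[OF D], simp)
  moreover have "2 ^ (2 * n) \<le> 2 ^ (2 * k + 1) * card ?O"
    using card_odd_sets_above_matching[OF Tm] n_gt by simp
  ultimately have "2 ^ (2 * n) \<le> 2 ^ (2 * k + 1) * card D"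
    by (meson le_trans mult_le_mono2)
  then have "real (2 ^ (2 * n)) \<le> real (2 ^ (2 * k + 1) * card D)" by (rule of_nat_mono)
  then have "(2::real) ^ (2 * n) \<le> real (card D) * 2 ^ (2 * k + 1)" by (simp add: mult.commute)
  also have "\<dots> \<le> N * (\<delta> * card (matchings n (2 * k))) * 2 ^ (2 * k + 1)"
    using assms(1) unfolding few_errors_def by (intro mult_right_mono) auto
  finally show False using assms(3) by (simp only: mult.assoc)
qed

end

section \<open>Unit propagation in rounds\<close>

definition models :: "'v passign \<Rightarrow> 'v cls set \<Rightarrow> bool" where
  "models \<psi> F \<longleftrightarrow> (\<forall>C\<in>F. \<exists>x\<in>C. lit_val \<psi> x = Some 1)"

lemma bit_option_cases:
  fixes b :: "bit option"
  obtains "b = None" | "b = Some 0" | "b = Some 1"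
  by (cases b) (auto, metis bit_not_one_iff)

lemma lit_val_compl: "lit_val \<phi> (compl_lit x) = Some 1 \<longleftrightarrow> lit_val \<phi> x = Some 0"
  by (cases x; cases "\<phi> (var_lit x)" rule: bit_option_cases) auto

lemma lit_val_map_add:
  "lit_val (\<psi> ++ \<phi>) x = (if lit_val \<phi> x = None then lit_val \<psi> x else lit_val \<phi> x)"
  by (cases x) (auto simp: map_add_def split: option.split)

text \<open>On the right \<open>\<phi>\<close> takes precedence. What \<open>\<psi>\<close> says
  about its variables is immaterial, as they do not occur in
  \<open>apply_pa \<phi> F\<close>.\<close>

lemma models_apply_pa: "models \<psi> (apply_pa \<phi> F) \<longleftrightarrow> models (\<psi> ++ \<phi>) F"
proof
  assume L: "models \<psi> (apply_pa \<phi> F)"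
  show "models (\<psi> ++ \<phi>) F"
    unfolding models_def
  proof
    fix C assume C: "C \<in> F"
    show "\<exists>x\<in>C. lit_val (\<psi> ++ \<phi>) x = Some 1"
    proof (cases "\<exists>x\<in>C. lit_val \<phi> x = Some 1")
      case True
      then obtain x where "x \<in> C" "lit_val \<phi> x = Some 1" by blast
      then show ?thesis by (intro bexI[of _ x]) (simp_all add: lit_val_map_add)
    next
      case False
      then have "{x \<in> C. lit_val \<phi> x \<noteq> Some 0} \<in> apply_pa \<phi> F" using C unfolding apply_pa_def by blast
      from L[unfolded models_def, rule_format, OF this]
      obtain x where x: "x \<in> C" "lit_val \<phi> x \<noteq> Some 0" "lit_val \<psi> x = Some 1" by blast
      then have "lit_val \<phi> x = None" using False by (cases "lit_val \<phi> x" rule: bit_option_cases) auto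
      then show ?thesis using x by (intro bexI[of _ x]) (simp_all add: lit_val_map_add)
    qed
  qed
next
  assume R: "models (\<psi> ++ \<phi>) F"
  show "models \<psi> (apply_pa \<phi> F)"
    unfolding models_def
  proof
    fix C' assume "C' \<in> apply_pa \<phi> F"
    then obtain C where C: "C \<in> F" "\<forall>x\<in>C. lit_val \<phi> x \<noteq> Some 1" "C' = {x \<in> C. lit_val \<phi> x \<noteq> Some 0}"
      unfolding apply_pa_def by blast
    then obtain x where x: "x \<in> C" "lit_val (\<psi> ++ \<phi>) x = Some 1" using R unfolding models_def by blast
    then have "lit_val \<phi> x = None" "lit_val \<psi> x = Some 1"
      using C(2) by (auto simp: lit_val_map_add split: if_splits)
    then show "\<exists>x\<in>C'. lit_val \<psi> x = Some 1" using x(1) C(3) by auto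
  qed
qed

lemma satisfiable_iff_models: "satisfiable F \<longleftrightarrow> (\<exists>\<psi>. finite (dom \<psi>) \<and> models \<psi> F)"
  unfolding satisfiable_def is_passign_def apply_pa_def models_def by blast

lemma satisfiable_apply_pa:
  assumes "finite (dom \<phi>)"
  shows "satisfiable (apply_pa \<phi> F) \<longleftrightarrow> (\<exists>\<psi>. finite (dom \<psi>) \<and> \<phi> \<subseteq>\<^sub>m \<psi> \<and> models \<psi> F)"
proof
  assume "satisfiable (apply_pa \<phi> F)"
  then obtain \<psi> where "finite (dom \<psi>)" "models (\<psi> ++ \<phi>) F"
    by (auto simp: satisfiable_iff_models models_apply_pa)
  then show "\<exists>\<psi>. finite (dom \<psi>) \<and> \<phi> \<subseteq>\<^sub>m \<psi> \<and> models \<psi> F"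
    using assms by (intro exI[of _ "\<psi> ++ \<phi>"]) auto
next
  assume "\<exists>\<psi>. finite (dom \<psi>) \<and> \<phi> \<subseteq>\<^sub>m \<psi> \<and> models \<psi> F"
  then obtain \<psi> where "finite (dom \<psi>)" "\<phi> \<subseteq>\<^sub>m \<psi>" "models \<psi> F" by blast
  moreover from this have "\<psi> ++ \<phi> = \<psi>"
    by (auto simp: map_add_def map_le_def dom_def fun_eq_iff split: option.split)
  ultimately show "satisfiable (apply_pa \<phi> F)" by (auto simp: satisfiable_iff_models models_apply_pa)
qed

text \<open>Propagation runs in parallel rounds on the unchanged \<open>F\<close>, with the
  assignment entering only through \<open>A\<close>. This makes every round a uniform formula in the
  assumptions.\<close>

primrec derived :: "'v cls set \<Rightarrow> 'v lit set \<Rightarrow> nat \<Rightarrow> 'v lit set" where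
  "derived F A 0 = A"
| "derived F A (Suc t) =
     derived F A t \<union> {y. \<exists>C\<in>F. y \<in> C \<and> (\<forall>z\<in>C - {y}. compl_lit z \<in> derived F A t)}"

definition refuted :: "'v cls set \<Rightarrow> 'v lit set \<Rightarrow> nat \<Rightarrow> bool" where
  "refuted F A t \<longleftrightarrow> (\<exists>C\<in>F. \<forall>z\<in>C. compl_lit z \<in> derived F A t)"

lemma models_derived:
  assumes "models \<psi> F" "\<And>y. y \<in> A \<Longrightarrow> lit_val \<psi> y = Some 1" "y \<in> derived F A t"
  shows "lit_val \<psi> y = Some 1"
  using assms(3)
proof (induction t arbitrary: y)
  case 0
  then show ?case using assms(2) by simp
next
  case (Suc t)
  show ?case
  proof (cases "y \<in> derived F A t")
    case True
    then show ?thesis by (rule Suc.IH)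
  next
    case False
    then obtain C where C: "C \<in> F" "y \<in> C" "\<forall>z\<in>C - {y}. compl_lit z \<in> derived F A t"
      using Suc.prems by auto
    then obtain x where x: "x \<in> C" "lit_val \<psi> x = Some 1" using assms(1) by (auto simp: models_def)
    have "x = y"
    proof (rule ccontr)
      assume "x \<noteq> y"
      then have "lit_val \<psi> (compl_lit x) = Some 1" using C(3) x(1) by (intro Suc.IH) blast
      then show False using x(2) by (simp add: lit_val_compl)
    qed
    then show ?thesis using x(2) by simp
  qed
qed

lemma models_not_refuted:
  assumes "models \<psi> F" "\<And>y. y \<in> A \<Longrightarrow> lit_val \<psi> y = Some 1"
  shows "\<not> refuted F A t"
proof
  assume "refuted F A t"
  then obtain C where C: "C \<in> F" "\<And>z. z \<in> C \<Longrightarrow> compl_lit z \<in> derived F A t" by (auto simp: refuted_def)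
  then obtain x where x: "x \<in> C" "lit_val \<psi> x = Some 1" using assms(1) by (auto simp: models_def)
  have "lit_val \<psi> (compl_lit x) = Some 1" using models_derived[OF assms C(2)[OF x(1)]] .
  then show False using x(2) by (simp add: lit_val_compl)
qed

text \<open>An invariant of \<open>unit_prop\<close> from which no conflict is reachable:
  \<open>P\<close> is closed under unit steps and falsifies no clause.\<close>

definition propagation_stable :: "'v lit set \<Rightarrow> 'v cls set \<Rightarrow> bool" where
  "propagation_stable P F \<longleftrightarrow> (\<forall>C\<in>F. (\<exists>z\<in>C. compl_lit z \<notin> P) \<and>
     (\<forall>y\<in>C. (\<forall>z\<in>C - {y}. compl_lit z \<in> P) \<longrightarrow> y \<in> P))"

lemma propagation_stable_apply_pa:
  assumes "propagation_stable P F" "\<And>y. lit_val \<phi> y = Some 1 \<Longrightarrow> y \<in> P"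
  shows "propagation_stable P (apply_pa \<phi> F)"
  unfolding propagation_stable_def
proof
  fix C' assume "C' \<in> apply_pa \<phi> F"
  then obtain C where C: "C \<in> F" "C' = {x \<in> C. lit_val \<phi> x \<noteq> Some 0}" unfolding apply_pa_def by blast
  have del: "compl_lit x \<in> P" if "x \<in> C" "x \<notin> C'" for x
    using that C(2) by (intro assms(2)) (simp add: lit_val_compl)
  have "\<exists>z\<in>C. compl_lit z \<notin> P" using assms(1) C(1) by (auto simp: propagation_stable_def)
  then have "\<exists>z\<in>C'. compl_lit z \<notin> P" using del by blast
  moreover have "y \<in> P" if y: "y \<in> C'" "\<forall>z\<in>C' - {y}. compl_lit z \<in> P" for y
  proof -
    have "\<forall>z\<in>C - {y}. compl_lit z \<in> P" using y(2) del by blast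
    moreover have "y \<in> C" using y(1) C(2) by blast
    ultimately show ?thesis using assms(1) C(1) unfolding propagation_stable_def by blast
  qed
  ultimately show "(\<exists>z\<in>C'. compl_lit z \<notin> P) \<and>
      (\<forall>y\<in>C'. (\<forall>z\<in>C' - {y}. compl_lit z \<in> P) \<longrightarrow> y \<in> P)" by blast
qed

lemma propagation_stable_unit_prop:
  "unit_prop F G \<Longrightarrow> propagation_stable P F \<Longrightarrow> {} \<notin> G"
proof (induction rule: unit_prop.induct)
  case (conflict F)
  then show ?case unfolding propagation_stable_def by blast
next
  case (unit F x G)
  have "x \<in> P" using unit.prems unit.hyps(2) unfolding propagation_stable_def by blast
  then show ?case using unit.prems
    by (intro unit.IH propagation_stable_apply_pa) (auto simp: lit_val_set_true split: if_splits)
next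
  case (stop F)
  then show ?case by blast
qed

lemma finite_vars_apply_pa:
  assumes "finite (vars F)" shows "finite (vars (apply_pa \<phi> F))"
proof -
  have "vars (apply_pa \<phi> F) \<subseteq> vars F" unfolding vars_def apply_pa_def by blast
  then show ?thesis using assms by (rule finite_subset)
qed

lemma propagation_stable_r1:
  assumes "finite (vars F)" "propagation_stable P F" "\<And>y. lit_val \<phi> y = Some 1 \<Longrightarrow> y \<in> P"
  shows "r1 (apply_pa \<phi> F) \<noteq> {{}}"
proof -
  obtain G where G: "unit_prop (apply_pa \<phi> F) G"
    using unit_prop_ex_finite[OF finite_vars_apply_pa[OF assms(1)]] by blast
  have "{} \<notin> G"
    using propagation_stable_unit_prop[OF G propagation_stable_apply_pa[OF assms(2,3)]] .
  then show ?thesis using r1_eq[OF G] by blast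
qed

definition lits :: "'v cls set \<Rightarrow> 'v lit set" where
  "lits F = Pos ` vars F \<union> Neg ` vars F"

lemma var_in_lits: "var_lit y \<in> vars F \<Longrightarrow> y \<in> lits F"
  by (cases y) (auto simp: lits_def)

lemma mem_lits: "C \<in> F \<Longrightarrow> y \<in> C \<Longrightarrow> y \<in> lits F"
  by (rule var_in_lits) (auto simp: vars_def)

lemma var_lit_compl [simp]: "var_lit (compl_lit y) = var_lit y"
  by (cases y) auto

lemma compl_mem_lits: "C \<in> F \<Longrightarrow> y \<in> C \<Longrightarrow> compl_lit y \<in> lits F"
  by (rule var_in_lits) (auto simp: vars_def)

lemma finite_lits: "finite (vars F) \<Longrightarrow> finite (lits F)"
  by (simp add: lits_def)

lemma derived_subset_lits: "A \<subseteq> lits F \<Longrightarrow> derived F A t \<subseteq> lits F"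
  by (induction t) (auto intro: mem_lits)

lemma derived_mono: "s \<le> t \<Longrightarrow> derived F A s \<subseteq> derived F A t"
  by (rule lift_Suc_mono_le[of "derived F A"]) auto

text \<open>Each round before stabilisation adds a literal, and only \<open>card (lits F)\<close>
  literals are available.\<close>

lemma derived_stabilises:
  assumes "finite (vars F)" "A \<subseteq> lits F"
  shows "\<exists>t\<le>card (lits F). derived F A (Suc t) = derived F A t"
proof (rule ccontr)
  assume "\<not> ?thesis"
  then have ne: "derived F A (Suc t) \<noteq> derived F A t" if "t \<le> card (lits F)" for t using that by blast
  have fin: "finite (derived F A t)" for t
    using finite_subset[OF derived_subset_lits[OF assms(2)] finite_lits[OF assms(1)]] .
  have "t \<le> card (lits F) + 1 \<Longrightarrow> t \<le> card (derived F A t)" for t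
  proof (induction t)
    case (Suc t)
    have "derived F A t \<subset> derived F A (Suc t)" using ne[of t] derived_mono[of t "Suc t" F A] Suc.prems by auto
    then have "card (derived F A t) < card (derived F A (Suc t))" using fin by (rule psubset_card_mono[rotated])
    then show ?case using Suc by simp
  qed simp
  from this[of "card (lits F) + 1"] have "card (lits F) < card (derived F A (card (lits F) + 1))" by simp
  moreover have "card (derived F A (card (lits F) + 1)) \<le> card (lits F)"
    by (rule card_mono[OF finite_lits[OF assms(1)] derived_subset_lits[OF assms(2)]])
  ultimately show False by simp
qed

text \<open>Completeness of the rounds. If no clause is falsified after \<open>card (lits F)\<close>
  of them, then the set reached at stabilisation is \<open>propagation_stable\<close>, so
  \<open>r1\<close> finds no conflict either.\<close>

lemma r1_refuted:
  assumes "finite (vars F)" "r1 (apply_pa \<phi> F) = {{}}" "dom \<phi> \<subseteq> vars F"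
  shows "refuted F {y. lit_val \<phi> y = Some 1} (card (lits F))"
proof (rule ccontr)
  let ?A = "{y. lit_val \<phi> y = Some 1}"
  assume nr: "\<not> refuted F ?A (card (lits F))"
  have "?A \<subseteq> lits F"
  proof
    fix y assume "y \<in> ?A"
    then have "var_lit y \<in> dom \<phi>" by (cases y) auto
    then show "y \<in> lits F" using assms(3) by (intro var_in_lits) blast
  qed
  then obtain t where t: "t \<le> card (lits F)" "derived F ?A (Suc t) = derived F ?A t"
    using derived_stabilises[OF assms(1)] by blast
  have "propagation_stable (derived F ?A t) F"
    unfolding propagation_stable_def
  proof (intro ballI conjI impI)
    fix C assume C: "C \<in> F"
    then obtain z where "z \<in> C" "compl_lit z \<notin> derived F ?A (card (lits F))"
      using nr by (auto simp: refuted_def)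
    then show "\<exists>z\<in>C. compl_lit z \<notin> derived F ?A t" using derived_mono[OF t(1)] by blast
    fix y assume "y \<in> C" "\<forall>z\<in>C - {y}. compl_lit z \<in> derived F ?A t"
    then have "y \<in> derived F ?A (Suc t)" using C by auto
    then show "y \<in> derived F ?A t" by (simp only: t(2))
  qed
  moreover have "y \<in> derived F ?A t" if "lit_val \<phi> y = Some 1" for y
    using that derived_mono[of 0 t F ?A] by auto
  ultimately have "r1 (apply_pa \<phi> F) \<noteq> {{}}" by (rule propagation_stable_r1[OF assms(1)])
  then show False using assms(2) by contradiction
qed

lemma card_vars_le:
  assumes "is_clause_set F" shows "card (vars F) \<le> lit_count F"
proof -
  have fin: "finite F" "\<And>C. C \<in> F \<Longrightarrow> finite C" using assms by (auto simp: is_clause_set_def is_clause_def)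
  have "card (vars F) \<le> card (\<Union>F)" unfolding vars_def using fin by (intro card_image_le) blast
  also have "\<dots> \<le> lit_count F" unfolding lit_count_def by (rule card_Union_le_sum_card)
  finally show ?thesis .
qed

lemma card_lits_le:
  assumes "is_clause_set F" shows "card (lits F) \<le> 2 * lit_count F"
proof -
  have "card (lits F) \<le> card (Pos ` vars F) + card (Neg ` vars F)" unfolding lits_def by (rule card_Un_le)
  also have "\<dots> \<le> card (vars F) + card (vars F)"
    using finite_vars[OF assms] by (intro add_mono card_image_le)
  finally show ?thesis using card_vars_le[OF assms] by linarith
qed

text \<open>Nonempty clauses count at least once in \<open>lit_count\<close>; the summand 1 accounts
  for the empty clause.\<close>

lemma card_clause_set_le:
  assumes "is_clause_set F" shows "card F \<le> lit_count F + 1"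
proof -
  have fin: "finite F" "\<And>C. C \<in> F \<Longrightarrow> finite C" using assms by (auto simp: is_clause_set_def is_clause_def)
  have "card F \<le> card (insert {} (F - {{}}))" using fin by (intro card_mono) auto
  also have "\<dots> = card (F - {{}}) + 1" using fin by (subst card_insert_disjoint) auto
  also have "card (F - {{}}) = (\<Sum>C\<in>F - {{}}. 1)" by simp
  also have "\<dots> \<le> (\<Sum>C\<in>F - {{}}. card C)"
    using fin by (intro sum_mono) (metis DiffD1 DiffD2 One_nat_def Suc_leI card_gt_0_iff singletonI)
  also have "\<dots> \<le> lit_count F" unfolding lit_count_def using fin by (intro sum_mono2) auto
  finally show ?thesis by simp
qed

section \<open>The odd factor constraints\<close>

text \<open>An XOR-clause requires an even sum; negating the literal with index 0 makes it odd.\<close>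

definition edge_lit :: "nat \<Rightarrow> nat \<times> nat \<Rightarrow> nat lit" where
  "edge_lit m e = (if m = 0 then Neg (prod_encode e) else Pos (prod_encode e))"

definition row_clause :: "nat \<Rightarrow> nat \<Rightarrow> nat cls" where
  "row_clause n i = (\<lambda>j. edge_lit j (i, j)) ` {..<n}"

definition col_clause :: "nat \<Rightarrow> nat \<Rightarrow> nat cls" where
  "col_clause n j = (\<lambda>i. edge_lit i (i, j)) ` {..<n}"

definition odd_factor_xor :: "nat \<Rightarrow> nat cls set" where
  "odd_factor_xor n = row_clause n ` {..<n} \<union> col_clause n ` {..<n}"

lemma var_edge_lit [simp]: "var_lit (edge_lit m e) = prod_encode e"
  by (simp add: edge_lit_def)

lemma is_clause_inj_var:
  assumes "finite C" "inj_on var_lit C"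
  shows "is_clause C"
  unfolding is_clause_def using assms by (metis compl_neq(1) inj_onD var_lit_compl)

lemma is_clause_set_odd_factor_xor: "is_clause_set (odd_factor_xor n)"
proof -
  have "is_clause (row_clause n i)" "is_clause (col_clause n i)" for i
    by (rule is_clause_inj_var; auto simp: row_clause_def col_clause_def inj_on_def)+
  then show ?thesis by (auto simp: is_clause_set_def odd_factor_xor_def)
qed

lemma lit_count_odd_factor_xor: "lit_count (odd_factor_xor n) \<le> 2 * n\<^sup>2"
proof -
  have "card C \<le> n" if "C \<in> odd_factor_xor n" for C
    using that card_image_le[of "{..<n}"] by (auto simp: odd_factor_xor_def row_clause_def col_clause_def)
  then have "lit_count (odd_factor_xor n) \<le> card (odd_factor_xor n) * n"
    unfolding lit_count_def using sum_bounded_above[of "odd_factor_xor n" card n] by simp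
  also have "card (odd_factor_xor n) \<le> card (row_clause n ` {..<n}) + card (col_clause n ` {..<n})"
    unfolding odd_factor_xor_def by (rule card_Un_le)
  also have "\<dots> \<le> n + n" by (intro add_mono) (use card_image_le[of "{..<n}"] in force)+
  finally show ?thesis by (simp add: power2_eq_square algebra_simps)
qed

lemma vars_odd_factor_xor: "vars (odd_factor_xor n) = prod_encode ` ({..<n} \<times> {..<n})"
proof -
  have "vars (odd_factor_xor n) = (\<Union>i<n. var_lit ` row_clause n i) \<union> (\<Union>j<n. var_lit ` col_clause n j)"
    by (auto simp: vars_def odd_factor_xor_def)
  then show ?thesis by (auto simp: row_clause_def col_clause_def image_image)
qed

lemma sum_edge_lits:
  assumes "0 < n" "inj_on e {..<n}" "\<And>m. m < n \<Longrightarrow> \<phi> (prod_encode (e m)) = Some (y m)"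
  shows "(\<Sum>x\<in>(\<lambda>m. edge_lit m (e m)) ` {..<n}. the (lit_val \<phi> x)) = 1 + (\<Sum>m<n. y m)"
proof -
  have "inj_on (\<lambda>m. edge_lit m (e m)) {..<n}"
    using assms(2) unfolding inj_on_def by (metis prod_encode_eq var_edge_lit)
  then have "(\<Sum>x\<in>(\<lambda>m. edge_lit m (e m)) ` {..<n}. the (lit_val \<phi> x))
      = (\<Sum>m<n. the (lit_val \<phi> (edge_lit m (e m))))" by (rule sum.reindex_cong) auto
  also have "\<dots> = (\<Sum>m<n. (if m = 0 then 1 else 0) + y m)"
    using assms(3) by (intro sum.cong) (auto simp: edge_lit_def)
  also have "\<dots> = (\<Sum>m<n. if m = 0 then 1 else 0) + (\<Sum>m<n. y m)" by (rule sum.distrib)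
  also have "(\<Sum>m<n. if m = 0 then 1 else 0 :: bit) = 1" using assms(1) by (subst sum.delta) auto
  finally show ?thesis .
qed

lemma xor_sat_odd_factor_xor:
  assumes "0 < n" "\<And>i j. i < n \<Longrightarrow> j < n \<Longrightarrow> \<phi> (prod_encode (i, j)) = Some (y i j)"
  shows "xor_sat \<phi> (odd_factor_xor n) \<longleftrightarrow>
    (\<forall>i<n. (\<Sum>j<n. y i j) = 1) \<and> (\<forall>j<n. (\<Sum>i<n. y i j) = 1)"
proof -
  have "(\<Sum>x\<in>row_clause n i. the (lit_val \<phi> x)) = 1 + (\<Sum>j<n. y i j)" if "i < n" for i
    unfolding row_clause_def using assms that by (intro sum_edge_lits) (auto simp: inj_on_def)
  moreover have "(\<Sum>x\<in>col_clause n j. the (lit_val \<phi> x)) = 1 + (\<Sum>i<n. y i j)" if "j < n" for j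
    unfolding col_clause_def using assms that
    by (intro sum_edge_lits[where e = "\<lambda>i. (i, j)"]) (auto simp: inj_on_def)
  moreover have "1 + b = 0 \<longleftrightarrow> b = 1" for b :: bit by (cases b) auto
  ultimately show ?thesis unfolding xor_sat_def odd_factor_xor_def by (auto simp: ball_Un)
qed

lemma of_nat_bit: "(of_nat m :: bit) = (if odd m then 1 else 0)"
  by (induction m) auto

text \<open>Summing the equations of the vertices in \<open>X\<close> counts every edge inside \<open>X\<close> twice and
  no other available edge at all.\<close>

lemma no_odd_factor_monochrom:
  fixes y :: "nat \<Rightarrow> nat \<Rightarrow> bit"
  assumes "X \<subseteq> verts n" "odd (card X)"
    and y0: "\<And>i j. i < n \<Longrightarrow> j < n \<Longrightarrow> (i, j) \<notin> monochrom X \<Longrightarrow> y i j = 0"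
    and row: "\<And>i. i < n \<Longrightarrow> (\<Sum>j<n. y i j) = 1" and col: "\<And>j. j < n \<Longrightarrow> (\<Sum>i<n. y i j) = 1"
  shows False
proof -
  let ?a = "\<lambda>i. if Inl i \<in> X then 1 else 0 :: bit"
  let ?b = "\<lambda>j. if Inr j \<in> X then 1 else 0 :: bit"
  let ?A = "{i. i < n \<and> Inl i \<in> X}" and ?B = "{j. j < n \<and> Inr j \<in> X}"
  have zero: "(?a i + ?b j) * y i j = 0" if "i < n" "j < n" for i j
    using y0[OF that] by (auto simp: monochrom_def)
  have "X = ?A <+> ?B"
    using assms(1) unfolding verts_def Plus_def by auto
  then have "card X = card ?A + card ?B" using card_Plus[of ?A ?B] by simp
  then have "(1 :: bit) = of_nat (card ?A) + of_nat (card ?B)"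
    using assms(2) of_nat_bit[of "card X"] by (metis of_nat_add)
  also have "\<dots> = (\<Sum>i<n. ?a i) + (\<Sum>j<n. ?b j)"
  proof -
    have "{..<n} \<inter> {i. Inl i \<in> X} = ?A" "{..<n} \<inter> {i. Inr i \<in> X} = ?B" by auto
    then show ?thesis by (simp add: sum.If_cases)
  qed
  also have "\<dots> = (\<Sum>i<n. ?a i * (\<Sum>j<n. y i j)) + (\<Sum>j<n. ?b j * (\<Sum>i<n. y i j))"
    using row col by (intro arg_cong2[of _ _ _ _ "(+)"] sum.cong) auto
  also have "\<dots> = (\<Sum>i<n. \<Sum>j<n. ?a i * y i j) + (\<Sum>j<n. \<Sum>i<n. ?b j * y i j)"
    by (simp only: sum_distrib_left)
  also have "(\<Sum>j<n. \<Sum>i<n. ?b j * y i j) = (\<Sum>i<n. \<Sum>j<n. ?b j * y i j)" by (rule sum.swap)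
  also have "(\<Sum>i<n. \<Sum>j<n. ?a i * y i j) + \<dots> = (\<Sum>i<n. \<Sum>j<n. (?a i + ?b j) * y i j)"
    by (simp only: sum.distrib distrib_right)
  also have "\<dots> = 0" using zero by (intro sum.neutral ballI) simp
  finally show False by simp
qed

section \<open>Restricting the constraints to the edges of a graph\<close>

definition restrict_edges :: "nat \<Rightarrow> (nat \<times> nat) set \<Rightarrow> nat passign" where
  "restrict_edges n S v =
     (if prod_decode v \<in> {..<n} \<times> {..<n} - S then Some 0 else None)"

lemma dom_restrict_edges: "dom (restrict_edges n S) \<subseteq> vars (odd_factor_xor n)"
  unfolding vars_odd_factor_xor
proof
  fix v assume "v \<in> dom (restrict_edges n S)"
  then have "prod_decode v \<in> {..<n} \<times> {..<n}" by (auto simp: restrict_edges_def split: if_splits)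
  then have "prod_encode (prod_decode v) \<in> prod_encode ` ({..<n} \<times> {..<n})" by (rule imageI)
  then show "v \<in> prod_encode ` ({..<n} \<times> {..<n})" by simp
qed

lemma finite_dom_restrict_edges: "finite (dom (restrict_edges n S))"
  using dom_restrict_edges by (rule finite_subset) (simp add: vars_odd_factor_xor)

text \<open>These are the assumptions from which propagation starts. They become fewer when
  \<open>S\<close> grows, so that \<open>y \<notin> derived F (true_lits n S) t\<close> is monotone
  in \<open>S\<close>.\<close>

definition true_lits :: "nat \<Rightarrow> (nat \<times> nat) set \<Rightarrow> nat lit set" where
  "true_lits n S = {y. lit_val (restrict_edges n S) y = Some 1}"

lemma mem_true_lits:
  "y \<in> true_lits n S \<longleftrightarrow> (\<exists>v. y = Neg v \<and> prod_decode v \<in> {..<n} \<times> {..<n} - S)"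
  by (cases y) (auto simp: true_lits_def restrict_edges_def)

lemma cnf_representation_models:
  assumes "cnf_representation F' F" "finite (vars F)" "finite (dom \<phi>)" "models \<phi> F'" "dom \<phi> \<supseteq> vars F"
  shows "xor_sat \<phi> F"
proof -
  have "dom (\<phi> |` vars F) = vars F" using assms(5) by auto
  moreover have "satisfiable (apply_pa (\<phi> |` vars F) F')"
    using assms by (subst satisfiable_apply_pa) (auto simp: map_le_def intro!: exI[of _ \<phi>])
  ultimately have "xor_sat (\<phi> |` vars F) F" using assms(1) by (simp add: cnf_representation_def)
  moreover have "lit_val (\<phi> |` vars F) x = lit_val \<phi> x" if "C \<in> F" "x \<in> C" for C x
  proof -
    have "var_lit x \<in> vars F" using that by (auto simp: vars_def)
    then show ?thesis by (cases x) auto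
  qed
  ultimately show ?thesis unfolding xor_sat_def by (metis (no_types, lifting) sum.cong)
qed

text \<open>A model of \<open>F'\<close> compatible with the restriction would encode an odd factor
  inside \<open>monochrom X\<close>, which parity forbids. The UR property turns this
  unsatisfiability into a conflict of \<open>r1\<close>, and \<open>r1_refuted\<close> turns the
  conflict into a refutation in rounds.\<close>

lemma ur_representation_refutes_monochrom:
  assumes ur: "ur_representation F' (odd_factor_xor n)" and "0 < n" "X \<subseteq> verts n" "odd (card X)"
  shows "refuted F' (true_lits n (monochrom X)) (card (lits F'))"
proof -
  let ?F = "odd_factor_xor n" and ?\<phi> = "restrict_edges n (monochrom X)"
  have cnf: "cnf_representation F' ?F" using ur by (simp add: ur_representation_def)
  then have cs: "is_clause_set F'" "vars ?F \<subseteq> vars F'" by (simp_all add: cnf_representation_def)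
  have "\<not> satisfiable (apply_pa ?\<phi> F')"
  proof
    assume "satisfiable (apply_pa ?\<phi> F')"
    then obtain \<psi> where psi: "finite (dom \<psi>)" "?\<phi> \<subseteq>\<^sub>m \<psi>" "models \<psi> F'"
      using finite_dom_restrict_edges by (auto simp: satisfiable_apply_pa)
    \<comment> \<open>The model may leave edge variables open; the default 0 fills them in, and
      values that \<open>\<psi>\<close> assigns are kept.\<close>
    let ?\<chi> = "(\<lambda>v. if v \<in> vars ?F then Some 0 else None) ++ \<psi>"
    define y where "y i j = the (?\<chi> (prod_encode (i, j)))" for i j
    have chi: "?\<chi> (prod_encode (i, j)) = Some (y i j)" if "i < n" "j < n" for i j
      using that by (auto simp: y_def vars_odd_factor_xor map_add_def split: option.split)
    have fin: "finite (vars ?F)" by (simp add: vars_odd_factor_xor)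
    have dom0: "dom (\<lambda>v. if v \<in> vars ?F then Some (0 :: bit) else None) = vars ?F"
      by (auto simp: dom_def)
    have "xor_sat ?\<chi> ?F"
    proof (rule cnf_representation_models[OF cnf fin])
      show "finite (dom ?\<chi>)" using psi(1) fin by (simp only: dom_map_add dom0 finite_Un)
      show "vars ?F \<subseteq> dom ?\<chi>" by (simp only: dom_map_add dom0) blast
      have "lit_val ?\<chi> x = Some 1" if "lit_val \<psi> x = Some 1" for x
        using that by (simp add: lit_val_map_add)
      then show "models ?\<chi> F'" using psi(3) unfolding models_def by blast
    qed
    then have rc: "\<And>i. i < n \<Longrightarrow> (\<Sum>j<n. y i j) = 1" "\<And>j. j < n \<Longrightarrow> (\<Sum>i<n. y i j) = 1"
      using xor_sat_odd_factor_xor[OF assms(2), of ?\<chi> y] chi by auto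
    have "y i j = 0" if "i < n" "j < n" "(i, j) \<notin> monochrom X" for i j
    proof -
      have "?\<phi> (prod_encode (i, j)) = Some 0" using that by (simp add: restrict_edges_def)
      then have "\<psi> (prod_encode (i, j)) = Some 0" using psi(2) unfolding map_le_def by (metis domI)
      then show ?thesis by (simp add: y_def map_add_def)
    qed
    then show False using no_odd_factor_monochrom[OF assms(3,4), of y] rc by blast
  qed
  then have "r1 (apply_pa ?\<phi> F') = {{}}"
    using ur[unfolded ur_representation_def, THEN conjunct2, rule_format, of ?\<phi>]
      dom_restrict_edges finite_dom_restrict_edges by (simp add: is_passign_def)
  then show ?thesis
    unfolding true_lits_def using finite_vars[OF cs(1)] order_trans[OF dom_restrict_edges cs(2)]
    by (intro r1_refuted)
qed

text \<open>The matrix of \<open>\<pi>\<close> satisfies the constraints, so it extends to a model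
  of \<open>F'\<close>. All edges outside the graph of \<open>\<pi>\<close> are 0 in it, and
  propagation from true assumptions is sound for any number \<open>t\<close> of rounds.\<close>

lemma cnf_representation_accepts_perm:
  assumes cnf: "cnf_representation F' (odd_factor_xor n)" and "0 < n" and pi: "\<pi> permutes {..<n}"
  shows "\<not> refuted F' (true_lits n (perm_graph n \<pi>)) t"
proof -
  let ?F = "odd_factor_xor n"
  define y where "y i j = (if j = \<pi> i then 1 else 0 :: bit)" for i j
  define \<phi> where "\<phi> v = (if v \<in> vars ?F then Some (case prod_decode v of (i, j) \<Rightarrow> y i j) else None)" for v
  have dom: "dom \<phi> = vars ?F" by (auto simp: \<phi>_def dom_def)
  have fin: "finite (dom \<phi>)" by (simp add: dom vars_odd_factor_xor)
  have val: "\<phi> (prod_encode (i, j)) = Some (y i j)" if "i < n" "j < n" for i j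
    using that by (simp add: \<phi>_def vars_odd_factor_xor image_iff)
  have "(\<Sum>j<n. y i j) = 1" if "i < n" for i
    using that permutes_in_image[OF pi, of i] by (simp add: y_def)
  moreover have "(\<Sum>i<n. y i j) = 1" if "j < n" for j
  proof -
    have "(\<Sum>i<n. y i j) = (\<Sum>i<n. if i = inv \<pi> j then 1 else 0)"
      unfolding y_def using permutes_inverses[OF pi] by (intro sum.cong) metis+
    also have "\<dots> = 1" using that permutes_in_image[OF permutes_inv[OF pi], of j] by simp
    finally show ?thesis .
  qed
  ultimately have "xor_sat \<phi> ?F" using xor_sat_odd_factor_xor[OF assms(2), of \<phi> y] val by blast
  then have "satisfiable (apply_pa \<phi> F')" using cnf dom by (simp add: cnf_representation_def)
  then obtain \<psi> where psi: "\<phi> \<subseteq>\<^sub>m \<psi>" "models \<psi> F'" using fin by (auto simp: satisfiable_apply_pa)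
  have "lit_val \<psi> x = Some 1" if "x \<in> true_lits n (perm_graph n \<pi>)" for x
  proof -
    obtain i j where x: "x = Neg (prod_encode (i, j))" "i < n" "j < n" "(i, j) \<notin> perm_graph n \<pi>"
      using \<open>x \<in> _\<close> unfolding mem_true_lits
      by (metis DiffD1 DiffD2 lessThan_iff mem_Sigma_iff prod_decode_inverse surj_pair)
    then have "y i j = 0" by (auto simp: y_def perm_graph_def)
    then have "\<phi> (prod_encode (i, j)) = Some 0" using val x by simp
    then have "\<psi> (prod_encode (i, j)) = Some 0" using psi(1) unfolding map_le_def by (metis domI)
    then show ?thesis using x(1) by simp
  qed
  then show ?thesis by (rule models_not_refuted[OF psi(2)])
qed

section \<open>The lower bound\<close>

context matching_approximation
begin

text \<open>A literal \<open>y\<close> is still underived after a round iff it was before and every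
  clause containing \<open>y\<close> has another literal whose complement was underived. For each
  literal this is a conjunction of \<open>card F + 1\<close> properties, each approximable without
  new errors.\<close>

lemma approximable_derived:
  assumes "is_clause_set F"
  shows "\<exists>D E. few_errors (t * (card (lits F) * (card F + 1))) D E \<and>
    (\<forall>y\<in>lits F. approximable D E (\<lambda>S. y \<notin> derived F (true_lits n S) t))"
proof (induction t)
  case 0
  have "approximable {} {} (\<lambda>S. y \<notin> true_lits n S)" for y
  proof (cases y)
    case (Pos v)
    then have "(\<lambda>S. y \<notin> true_lits n S) = (\<lambda>S. True)" by (simp add: mem_true_lits)
    then show ?thesis by (simp only: approximable_True)
  next
    case (Neg v)
    show ?thesis
    proof (cases "prod_decode v \<in> {..<n} \<times> {..<n}")
      case True
      then have "(\<lambda>S. y \<notin> true_lits n S) = (\<lambda>S. prod_decode v \<in> S)" by (simp add: mem_true_lits Neg)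
      then show ?thesis by (simp only: approximable_mem)
    next
      case False
      then have "(\<lambda>S. y \<notin> true_lits n S) = (\<lambda>S. True)" by (simp add: mem_true_lits Neg)
      then show ?thesis by (simp only: approximable_True)
    qed
  qed
  then show ?case using few_errors_0 by (intro exI[of _ "{}"] conjI ballI) simp_all
next
  case (Suc t)
  then obtain D E where DE: "few_errors (t * (card (lits F) * (card F + 1))) D E"
    "\<And>y. y \<in> lits F \<Longrightarrow> approximable D E (\<lambda>S. y \<notin> derived F (true_lits n S) t)" by blast
  \<comment> \<open>\<open>None\<close> stands for the conjunct that \<open>y\<close> was not
    derived before, \<open>Some C\<close> for the one given by the clause \<open>C\<close>.\<close>
  let ?I = "insert None (Some ` F)"
  define g where "g y i S = (case i of None \<Rightarrow> y \<notin> derived F (true_lits n S) t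
    | Some C \<Rightarrow> y \<in> C \<longrightarrow> (\<exists>z\<in>C - {y}. compl_lit z \<notin> derived F (true_lits n S) t))" for y i S
  have finF: "finite F" using assms by (simp add: is_clause_set_def)
  have cI: "card ?I = card F + 1" using finF by (subst card_insert_disjoint) (auto simp: card_image)
  have "approximable D E (g y i)" if y: "y \<in> lits F" and i: "i \<in> ?I" for y i
  proof (cases i)
    case None
    then have "g y i = (\<lambda>S. y \<notin> derived F (true_lits n S) t)" by (simp add: g_def fun_eq_iff)
    then show ?thesis using DE(2)[OF y] by simp
  next
    case (Some C)
    then have C: "C \<in> F" using i by auto
    have "approximable D E (\<lambda>S. \<exists>z\<in>C - {y}. compl_lit z \<notin> derived F (true_lits n S) t)"
      using compl_mem_lits[OF C] by (intro approximable_Bex DE(2)) blast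
    then have "approximable D E (\<lambda>S. y \<in> C \<longrightarrow> (\<exists>z\<in>C - {y}. compl_lit z \<notin> derived F (true_lits n S) t))"
      by (rule approximable_imp)
    moreover have "g y i = (\<lambda>S. y \<in> C \<longrightarrow> (\<exists>z\<in>C - {y}. compl_lit z \<notin> derived F (true_lits n S) t))"
      by (simp add: g_def Some fun_eq_iff)
    ultimately show ?thesis by simp
  qed
  from approximable_family_Ball[of "lits F" ?I _ _ _ g, OF finite_lits[OF finite_vars[OF assms]] _ DE(1) this]
  obtain D' E' where D'E': "few_errors (t * (card (lits F) * (card F + 1)) + card (lits F) * card ?I) D' E'"
    "\<And>y. y \<in> lits F \<Longrightarrow> approximable D' E' (\<lambda>S. \<forall>i\<in>?I. g y i S)"
    using finF by auto
  have "few_errors (Suc t * (card (lits F) * (card F + 1))) D' E'"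
    using D'E'(1) unfolding cI by (simp add: algebra_simps)
  moreover have "(\<lambda>S. \<forall>i\<in>?I. g y i S) = (\<lambda>S. y \<notin> derived F (true_lits n S) (Suc t))" for y
    by (rule ext) (auto simp: g_def)
  ultimately show ?case using D'E'(2) by auto
qed

lemma approximable_not_refuted:
  assumes "is_clause_set F"
  shows "\<exists>D E. few_errors (t * (card (lits F) * (card F + 1)) + card F) D E \<and>
    approximable D E (\<lambda>S. \<not> refuted F (true_lits n S) t)"
proof -
  obtain D E where DE: "few_errors (t * (card (lits F) * (card F + 1))) D E"
    "\<And>y. y \<in> lits F \<Longrightarrow> approximable D E (\<lambda>S. y \<notin> derived F (true_lits n S) t)"
    using approximable_derived[OF assms] by blast
  have "approximable D E (\<lambda>S. \<exists>z\<in>C. compl_lit z \<notin> derived F (true_lits n S) t)" if "C \<in> F" for C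
    using compl_mem_lits[OF that] by (intro approximable_Bex DE(2))
  from approximable_Ball[of F _ _ _ "\<lambda>C S. \<exists>z\<in>C. compl_lit z \<notin> derived F (true_lits n S) t", OF _ DE(1) this]
  show ?thesis using assms by (auto simp: is_clause_set_def refuted_def)
qed

text \<open>By completeness \<open>card (lits F)\<close> rounds suffice, and each takes
  \<open>card (lits F) * (card F + 1)\<close> binary conjunctions, so their number is at most cubic
  in \<open>lit_count F\<close>. Not being refuted would then be an approximable property separating
  permutations from odd colourings.\<close>

lemma ur_representation_large:
  assumes ur: "ur_representation F (odd_factor_xor n)"
    and "4 * (lit_count F + 2) ^ 3 \<le> N" "N < L ^ k"
    and "N * \<delta> * card (matchings n (2 * k)) * 2 ^ (2 * k + 1) < 2 ^ (2 * n)"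
  shows False
proof -
  have cnf: "cnf_representation F (odd_factor_xor n)" using ur by (simp add: ur_representation_def)
  have cs: "is_clause_set F" using cnf by (simp add: cnf_representation_def)
  let ?l = "lit_count F" and ?t = "card (lits F)"
  have n0: "0 < n" using n_gt by simp
  have "?t * (?t * (card F + 1)) + card F \<le> (2 * ?l) * ((2 * ?l) * (?l + 1 + 1)) + (?l + 1)"
    using card_lits_le[OF cs] card_clause_set_le[OF cs] by (intro add_mono mult_le_mono) auto
  also have "\<dots> \<le> 4 * (?l + 2) ^ 3" by (simp add: power3_eq_cube algebra_simps)
  finally have "?t * (?t * (card F + 1)) + card F \<le> N" using assms(2) by linarith
  then obtain D E where DE: "few_errors N D E" "approximable D E (\<lambda>S. \<not> refuted F (true_lits n S) ?t)"
    using approximable_not_refuted[OF cs, of ?t] few_errors_mono by blast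
  show False
    using cnf_representation_accepts_perm[OF cnf n0] ur_representation_refutes_monochrom[OF ur n0]
    by (intro approximable_not_separating[OF DE assms(4,3)]) simp_all
qed

end

section \<open>Elementary estimates and the choice of parameters\<close>

lemma poly_le_power:
  fixes p :: "real poly"
  shows "\<exists>K d :: nat. \<forall>m :: nat. poly p (real m) \<le> real (K * (m + 1) ^ d)"
proof (induction p)
  case 0
  then show ?case by auto
next
  case (pCons a p)
  then obtain K d :: nat where K: "\<And>m :: nat. poly p (real m) \<le> real (K * (m + 1) ^ d)" by blast
  obtain A :: nat where A: "a \<le> real A" using real_arch_simple by blast
  have "poly (pCons a p) (real m) \<le> real ((A + K) * (m + 1) ^ Suc d)" for m
  proof -
    \<comment> \<open>Horner's rule: the coefficient \<open>a\<close> is bounded by \<open>A\<close>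
      and the factor \<open>m\<close> by \<open>m + 1\<close>.\<close>
    have "poly (pCons a p) (real m) = a + real m * poly p (real m)" by simp
    also have "\<dots> \<le> real A + real m * real (K * (m + 1) ^ d)"
      using A K by (intro add_mono mult_left_mono) auto
    also have "\<dots> = real (A + m * (K * (m + 1) ^ d))" by simp
    also have "\<dots> \<le> real ((A + K) * (m + 1) ^ Suc d)"
    proof (rule of_nat_mono)
      have "A * 1 + K * (m * (m + 1) ^ d) \<le> A * (m + 1) ^ Suc d + K * ((m + 1) * (m + 1) ^ d)"
        by (intro add_mono mult_le_mono one_le_power) auto
      then show "A + m * (K * (m + 1) ^ d) \<le> (A + K) * (m + 1) ^ Suc d" by (simp add: algebra_simps)
    qed
    finally show ?thesis .
  qed
  then show ?case by blast
qed

text \<open>The induction step uses \<open>(Suc k) ^ 3 \<le> 2 * k ^ 3\<close>. The constant 30 is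
  \<open>6 * 5\<close>, from \<open>M_ge\<close> and the estimate
  \<open>p + 4 * k\<^sup>2 \<le> 5 * p * k\<^sup>2\<close>.\<close>

lemma cube_le_two_power:
  assumes "20 \<le> (k::nat)" shows "30 * k ^ 3 \<le> 2 ^ k"
  using assms
proof (induction k rule: nat_induct_at_least)
  case base
  then show ?case by simp
next
  case (Suc k)
  have "3 * k\<^sup>2 + 3 * k + 1 \<le> k ^ 3"
  proof -
    have "20 * k\<^sup>2 \<le> k * k\<^sup>2" "20 * k \<le> k * k" using Suc.hyps by (simp_all only: mult_le_mono1)
    then show ?thesis using Suc.hyps by (simp only: power2_eq_square power3_eq_cube mult.assoc)
  qed
  then have "(Suc k) ^ 3 \<le> 2 * k ^ 3" by (simp add: power2_eq_square power3_eq_cube algebra_simps)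
  then show ?case using Suc.IH by simp
qed

text \<open>From \<open>1 - x \<le> exp (- x)\<close> and \<open>2 \<le> exp 1\<close>.\<close>

lemma one_minus_inverse_power_le:
  assumes "2 \<le> (w::real)" "w = real W"
  shows "(1 - 1 / w) ^ W \<le> 1 / 2"
proof -
  have "(1 - 1 / w) ^ W \<le> exp (- (1 / w)) ^ W"
    using assms(1) exp_ge_add_one_self[of "- (1 / w)"] by (intro power_mono) auto
  also have "\<dots> = exp (- 1)" using assms by (simp flip: exp_of_nat_mult)
  also have "\<dots> \<le> 1 / 2" using exp_ge_add_one_self[of 1] by (simp add: exp_minus field_simps)
  finally show ?thesis .
qed

text \<open>With \<open>n = 2\<^bsup>20k\<^esup>\<close>, sunflowers with \<open>2\<^bsup>5k\<^esup>\<close> petals already occur in families of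
  \<open>2\<^bsup>18kr\<^esup>\<close> matchings with \<open>r\<close> edges, while a random permutation contains such a matching
  with probability about \<open>2\<^bsup>-20kr\<^esup>\<close>.\<close>

lemma ur_representation_odd_factor_xor_size:
  assumes "20 \<le> k" "ur_representation F (odd_factor_xor (2 ^ (20 * k)))" "B < k"
    "4 * (lit_count F + 2) ^ 3 \<le> 2 ^ (B * k)"
  shows False
proof -
  \<comment> \<open>With \<open>L = 2 ^ k\<close>, the product \<open>M ^ 3 * L\<close> is
    \<open>2 ^ (19 * k)\<close>; the remaining factor \<open>2 ^ k\<close> of \<open>n\<close>
    absorbs the term \<open>2 * k\<close> in \<open>n_ge\<close>.\<close>
  define n p M L :: nat where "n = 2 ^ (20 * k)" and "p = 2 ^ (5 * k)" and "M = 2 ^ (6 * k)" and "L = 2 ^ k"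
  have cube: "30 * k ^ 3 \<le> 2 ^ k" using assms(1) by (rule cube_le_two_power)
  have kL: "k < 2 ^ k" by (rule less_exp)
  have two: "(2::nat) \<le> 2 ^ k" using assms(1) by (intro self_le_power[of 2 k, simplified] ) auto
  have small: "2 * k \<le> 2 ^ (19 * k)"
  proof -
    have "2 * k \<le> 2 ^ k * 2 ^ k" using two kL by (intro mult_le_mono) auto
    also have "\<dots> = 2 ^ (2 * k)" by (simp add: mult_2 power_add)
    also have "\<dots> \<le> 2 ^ (19 * k)" by (intro power_increasing) auto
    finally show ?thesis .
  qed
  have n19: "2 * 2 ^ (19 * k) \<le> n"
  proof -
    have "n = 2 ^ k * 2 ^ (19 * k)" unfolding n_def power_add[symmetric] by simp
    then show ?thesis using two by simp
  qed
  interpret matching_approximation n k p M L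
  proof
    show "0 < k" using assms(1) by simp
    show "2 \<le> p" unfolding p_def using assms(1) by (intro self_le_power[of 2, simplified]) auto
    show "6 * k * (p + 4 * k\<^sup>2) \<le> M"
    proof -
      have "1 \<le> p" "1 \<le> k\<^sup>2" using assms(1) by (simp_all add: p_def)
      then have "p * 1 \<le> p * k\<^sup>2" "1 * (4 * k\<^sup>2) \<le> p * (4 * k\<^sup>2)" by (intro mult_le_mono; simp)+
      then have "p + 4 * k\<^sup>2 \<le> 5 * p * k\<^sup>2" by linarith
      then have "6 * k * (p + 4 * k\<^sup>2) \<le> 6 * k * (5 * p * k\<^sup>2)" by simp
      also have "\<dots> = (30 * k ^ 3) * p" by (simp add: power2_eq_square power3_eq_cube)
      also have "\<dots> \<le> 2 ^ k * p" using cube by simp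
      also have "\<dots> = M" unfolding p_def M_def power_add[symmetric] by simp
      finally show ?thesis .
    qed
    have "M ^ 3 * L = 2 ^ (19 * k)" unfolding M_def L_def power_mult[symmetric] power_add[symmetric] by simp
    then show "M ^ 3 * L \<le> n - 2 * k" using n19 small by simp
    show "k \<le> L" unfolding L_def using kL by simp
    have "0 < (2::nat) ^ (19 * k)" by simp
    then show "2 * k < n" using n19 small by linarith
  qed
  let ?N = "2 ^ (B * k) :: nat"
  have "?N < L ^ k"
    unfolding L_def power_mult[symmetric] using assms(1,3) by (intro power_strict_increasing) auto
  moreover have "real ?N * \<delta> * card (matchings n (2 * k)) * 2 ^ (2 * k + 1) < 2 ^ (2 * n)"
  proof -
    have "n\<^sup>2 + 1 \<le> 2 ^ (40 * k + 1)" unfolding n_def power_mult[symmetric] by simp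
    then have "(n\<^sup>2 + 1) ^ (2 * k) \<le> (2 ^ (40 * k + 1)) ^ (2 * k)" by (rule power_mono) simp
    then have "card (matchings n (2 * k)) \<le> 2 ^ ((40 * k + 1) * (2 * k))"
      using card_matchings_le[of n "2 * k"] unfolding power_mult by (rule order_trans[rotated])
    then have "real (card (matchings n (2 * k))) \<le> real (2 ^ ((40 * k + 1) * (2 * k)))" by (rule of_nat_mono)
    then have Q: "real (card (matchings n (2 * k))) \<le> 2 ^ ((40 * k + 1) * (2 * k))" by simp
    \<comment> \<open>Of the \<open>2 ^ (5 * k)\<close> petals, \<open>2 ^ (4 * k)\<close> bring a
      factor of at most 1/2, and this happens \<open>2 ^ k\<close> times. The bound
      \<open>(1 / 2) ^ (2 ^ k)\<close> then beats the other error factors, which are powers of 2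
      with exponents at most quadratic in \<open>k\<close>.\<close>
    have "p = 2 ^ (4 * k) * 2 ^ k" unfolding p_def power_add[symmetric] by simp
    then have "\<delta> = ((1 - 1 / 2 ^ (4 * k)) ^ (2 ^ (4 * k))) ^ (2 ^ k) * 2 ^ (2 * n)"
      unfolding \<delta>_def by (simp add: power_mult)
    also have "\<dots> \<le> (1 / 2) ^ (2 ^ k) * 2 ^ (2 * n)"
    proof (intro mult_right_mono power_mono one_minus_inverse_power_le)
      show "(2::real) \<le> 2 ^ (4 * k)" using assms(1) by (intro self_le_power) auto
    qed auto
    finally have "\<delta> \<le> (1 / 2) ^ (2 ^ k) * 2 ^ (2 * n)" .
    then have "real ?N * \<delta> * card (matchings n (2 * k)) * 2 ^ (2 * k + 1)
        \<le> real ?N * ((1 / 2) ^ (2 ^ k) * 2 ^ (2 * n)) * 2 ^ ((40 * k + 1) * (2 * k)) * 2 ^ (2 * k + 1)"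
      using Q \<delta>_nonneg by (intro mult_right_mono mult_mono) auto
    also have "\<dots> = 2 ^ (B * k + (40 * k + 1) * (2 * k) + (2 * k + 1)) * (1 / 2) ^ (2 ^ k) * 2 ^ (2 * n)"
      by (simp only: power_add of_nat_power of_nat_numeral mult_ac)
    also have "\<dots> < 1 * 2 ^ (2 * n)"
    proof (rule mult_strict_right_mono)
      have "B * k + (40 * k + 1) * (2 * k) + (2 * k + 1) < 2 ^ k"
      proof -
        have "B * k \<le> k * k" "20 * k \<le> k * k" "20 * (k * k) \<le> k * (k * k)" using assms(1,3) by (auto intro: mult_le_mono1)
        moreover have "20 \<le> k" by (rule assms(1))
        moreover have "30 * (k * (k * k)) \<le> 2 ^ k" using cube by (simp add: power3_eq_cube)
        moreover have "(40 * k + 1) * (2 * k) = 80 * (k * k) + 2 * k" by (simp add: algebra_simps)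
        ultimately show ?thesis by linarith
      qed
      then have "(2::real) ^ (B * k + (40 * k + 1) * (2 * k) + (2 * k + 1)) < 2 ^ (2 ^ k)"
        by (rule power_strict_increasing) simp
      then show "2 ^ (B * k + (40 * k + 1) * (2 * k) + (2 * k + 1)) * (1 / 2) ^ (2 ^ k) < (1::real)"
        by (simp add: power_one_over field_simps)
    qed simp
    finally show ?thesis by simp
  qed
  ultimately show False using assms(2,4) by (intro ur_representation_large) (auto simp: n_def)
qed

theorem theorem11p2:
  shows "\<not> (\<exists>p :: real poly. \<forall>F :: nat cls set. is_clause_set F \<longrightarrow>
           (\<exists>F' :: nat cls set. ur_representation F' F \<and>
              real (lit_count F') \<le> poly p (real (lit_count F))))"
proof
  assume "\<exists>p :: real poly. \<forall>F :: nat cls set. is_clause_set F \<longrightarrow>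
           (\<exists>F' :: nat cls set. ur_representation F' F \<and>
              real (lit_count F') \<le> poly p (real (lit_count F)))"
  then obtain p :: "real poly" where p: "\<And>F :: nat cls set. is_clause_set F \<Longrightarrow>
      \<exists>F' :: nat cls set. ur_representation F' F \<and> real (lit_count F') \<le> poly p (real (lit_count F))"
    by blast
  obtain K d :: nat where K: "\<And>m :: nat. poly p (real m) \<le> real (K * (m + 1) ^ d)"
    using poly_le_power by metis
  \<comment> \<open>\<open>2 ^ ((K + 42 * d) * k)\<close> will bound \<open>lit_count F'\<close>;
    the summand 2 adds \<open>2 * k\<close> to the exponent, the cube multiplies it by 3, and the
    factor 4 adds another \<open>2 * k\<close>.\<close>
  define B where "B = 3 * (K + 2 + 42 * d) + 2"
  \<comment> \<open>\<open>B < k\<close> gives \<open>2 ^ (B * k) < 2 ^ (k * k) = L ^ k\<close>, too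
    few conjunctions to spoil all permutations; \<open>20 \<le> k\<close> is the range of
    \<open>cube_le_two_power\<close>.\<close>
  define k where "k = max 20 (B + 1)"
  let ?F = "odd_factor_xor (2 ^ (20 * k))"
  have k: "20 \<le> k" "B < k" by (auto simp: k_def)
  obtain F' where F': "ur_representation F' ?F" "real (lit_count F') \<le> poly p (real (lit_count ?F))"
    using p[OF is_clause_set_odd_factor_xor] by blast
  have "real (lit_count F') \<le> real (K * (lit_count ?F + 1) ^ d)" using F'(2) K order_trans by blast
  then have "lit_count F' \<le> K * (lit_count ?F + 1) ^ d" by (simp only: of_nat_le_iff)
  \<comment> \<open>The constraints have size at most quadratic in \<open>2 ^ (20 * k)\<close>,
    which gives \<open>40 * k\<close> in the exponent; the other \<open>2 * k\<close> covers the
    constants.\<close>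
  also have "\<dots> \<le> 2 ^ (K * k) * (2 ^ (42 * k)) ^ d"
  proof (intro mult_le_mono power_mono)
    have "K < 2 ^ K" by (rule less_exp)
    also have "(2::nat) ^ K \<le> 2 ^ (K * k)" using k(1) by (intro power_increasing) auto
    finally show "K \<le> 2 ^ (K * k)" by simp
    have "lit_count ?F + 1 \<le> 2 * (2 ^ (20 * k))\<^sup>2 + 1"
      using lit_count_odd_factor_xor[of "2 ^ (20 * k)"] by simp
    also have "\<dots> \<le> 4 * (2 ^ (20 * k))\<^sup>2" by simp
    also have "\<dots> = 2 ^ (40 * k + 2)" by (simp add: power_add flip: power_mult)
    also have "\<dots> \<le> 2 ^ (42 * k)" using k(1) by (intro power_increasing) auto
    finally show "lit_count ?F + 1 \<le> 2 ^ (42 * k)" .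
  qed simp
  also have "\<dots> = 2 ^ ((K + 42 * d) * k)" by (simp add: algebra_simps flip: power_mult power_add)
  finally have l: "lit_count F' \<le> 2 ^ ((K + 42 * d) * k)" .
  have "lit_count F' + 2 \<le> 2 ^ ((K + 42 * d) * k) * 2 ^ 2"
  proof -
    have "1 \<le> (2::nat) ^ ((K + 42 * d) * k)" by simp
    then show ?thesis using l by (simp only: power2_eq_square)
  qed
  also have "\<dots> \<le> 2 ^ ((K + 42 * d) * k) * 2 ^ (2 * k)" using k(1) by (intro mult_le_mono power_increasing) auto
  also have "\<dots> = 2 ^ ((K + 2 + 42 * d) * k)" by (simp add: algebra_simps flip: power_add)
  finally have "(lit_count F' + 2) ^ 3 \<le> (2 ^ ((K + 2 + 42 * d) * k)) ^ 3" by (rule power_mono) simp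
  then have "4 * (lit_count F' + 2) ^ 3 \<le> 2 ^ (2 * k) * (2 ^ ((K + 2 + 42 * d) * k)) ^ 3"
  proof (rule mult_le_mono[rotated])
    have "(2::nat) ^ 2 \<le> 2 ^ (2 * k)" using k(1) by (intro power_increasing) auto
    then show "(4::nat) \<le> 2 ^ (2 * k)" by simp
  qed
  also have "\<dots> = 2 ^ (B * k)" by (simp add: B_def algebra_simps flip: power_mult power_add)
  finally show False using ur_representation_odd_factor_xor_size[OF k(1) F'(1) k(2)] by blast
qed

end
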